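(* Let $0\le\alpha<1$. Let $f=h+\overline{g}$ be harmonic in $\mathbb{D}$, where $h(z)=z+\sum_{n=2}^{\infty}a_nz^n$ and $g(z)=\sum_{n=2}^{\infty}b_nz^n$, and suppose that for all $n\ge 2$ $$|a_n|\le \tfrac16(2n+1)(n+1),\qquad |b_n|\le \tfrac16(2n-1)(n-1),\qquad \big||a_n|-|b_n|\big|\le n .$$ Then $D_f^{\epsilon}=zf_z-\epsilon\,\overline{z}f_{\overline{z}}$ ($|\epsilon|=1$) is fully convex of order $\alpha$ in $|z|<r_c(\alpha)$, where $r_c(\alpha)$ is the unique root in the interval $(0,1)$ of the equation $$1-\alpha -2(15-7 \alpha) r-12(1+3\alpha) r^2-2(29-21\alpha) r^3+29(1- \alpha ) r^4-12(1-\alpha) r^5+2(1- \alpha ) r^6= 0 .$$ In particular, $D_f^{\epsilon}$ is fully convex in $|z|<r_c\approx 0.0328348$, where $r_c$ is the unique root in the interval $(0,1)$ of the equation $$1-30 r-12 r^2-58 r^3+29 r^4-12 r^5+2 r^6=0 .$$ All results are sharp.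
   Context: $\mathbb{D}=\{z\in\mathbb{C}:|z|<1\}$. $\mathcal{H}$ is the class of complex-valued harmonic functions $f=h+\overline g$ on $\mathbb{D}$ with $h,g$ analytic in $\mathbb{D}$, $h(0)=g(0)=0$, $h'(0)=1$. $\mathcal{S}_H$ is the class of univalent sense-preserving $f\in\mathcal{H}$ (sense-preserving: $|g'(z)|<|h'(z)|$ in $\mathbb{D}$). For $f=h+\overline g$ and $|\epsilon|=1$, $D_f^{\epsilon}(z)=zf_z-\epsilon\,\overline z f_{\overline z}=zh'(z)-\epsilon\,\overline{zg'(z)}$. For $0\le\alpha<1$, a function $F\in\mathcal{S}_H$ is fully convex of order $\alpha$ (in $\mathbb{D}$) if it maps every circle $|z|=r<1$ in a one-to-one manner onto a convex curve satisfying $\frac{\partial}{\partial\theta}\left(\arg\left(\frac{\partial}{\partial\theta}F(re^{i\theta})\right)\right)>\alpha$ for $0\le\theta<2\pi$, $0<r<1$; "fully convex" means fully convex of order $0$. For $r\in(0,1)$, $F$ has such a property in $|z|<r$ if $F_r(z)=r^{-1}F(rz)$ has it in $\mathbb{D}$. "Sharp" means that the radius cannot be replaced by a larger number with the conclusion still holding for all data allowed by the hypotheses. *)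

theory Defs
  imports "HOL-Complex_Analysis.Complex_Analysis"
begin

abbreviation unit_disc :: "complex set" where
  "unit_disc \<equiv> ball 0 1"

definition wirtinger_z :: "(complex \<Rightarrow> complex) \<Rightarrow> complex \<Rightarrow> complex" where
  "wirtinger_z f z =
     (frechet_derivative f (at z) 1 - \<i> * frechet_derivative f (at z) \<i>) / 2"

definition wirtinger_zbar :: "(complex \<Rightarrow> complex) \<Rightarrow> complex \<Rightarrow> complex" where
  "wirtinger_zbar f z =
     (frechet_derivative f (at z) 1 + \<i> * frechet_derivative f (at z) \<i>) / 2"

definition D_op :: "complex \<Rightarrow> (complex \<Rightarrow> complex) \<Rightarrow> complex \<Rightarrow> complex" where
  "D_op \<epsilon> f z = z * wirtinger_z f z - \<epsilon> * cnj z * wirtinger_zbar f z"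

text \<open>The harmonic functions \<open>f = h + cnj g\<close> on the unit disc, with their decomposition.
  Only the values of \<open>f\<close>, \<open>h\<close>, \<open>g\<close> inside the disc matter.\<close>

definition harmonic_decomp ::
    "(complex \<Rightarrow> complex) \<Rightarrow> (complex \<Rightarrow> complex) \<Rightarrow> (complex \<Rightarrow> complex) \<Rightarrow> bool" where
  "harmonic_decomp f h g \<longleftrightarrow>
     h holomorphic_on unit_disc \<and> g holomorphic_on unit_disc \<and>
     (\<forall>z\<in>unit_disc. f z = h z + cnj (g z))"

definition class_SH :: "(complex \<Rightarrow> complex) set" where
  "class_SH = {f. \<exists>h g. harmonic_decomp f h g \<and>
      h 0 = 0 \<and> g 0 = 0 \<and> deriv h 0 = 1 \<and>
      inj_on f unit_disc \<and>
      (\<forall>z\<in>unit_disc. norm (deriv g z) < norm (deriv h z))}"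

text \<open>A closed curve is convex if its trace bounds a (bounded) convex domain.\<close>

definition convex_curve :: "complex set \<Rightarrow> bool" where
  "convex_curve C \<longleftrightarrow>
     (\<exists>K. K \<noteq> {} \<and> open K \<and> convex K \<and> bounded K \<and> C = frontier K)"

text \<open>\<open>tangent_arg \<gamma> \<phi>\<close>: the curve \<open>\<gamma>\<close> is regular and \<open>\<phi>\<close> is a continuous branch, along the
  whole curve, of the argument of its tangent vector. The argument is taken this way since
  \<open>Arg\<close> jumps by \<open>2 * pi\<close> on the negative real axis.\<close>

definition tangent_arg :: "(real \<Rightarrow> complex) \<Rightarrow> (real \<Rightarrow> real) \<Rightarrow> bool" where
  "tangent_arg \<gamma> \<phi> \<longleftrightarrow> continuous_on UNIV \<phi> \<and>
     (\<forall>\<theta>. \<exists>v. (\<gamma> has_vector_derivative v) (at \<theta>) \<and> v \<noteq> 0 \<and>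
          v = of_real (norm v) * cis (\<phi> \<theta>))"

definition fully_convex_of_order :: "real \<Rightarrow> (complex \<Rightarrow> complex) \<Rightarrow> bool" where
  "fully_convex_of_order \<alpha> F \<longleftrightarrow> F \<in> class_SH \<and>
     (\<forall>r. 0 < r \<and> r < 1 \<longrightarrow>
        inj_on F (sphere 0 r) \<and> convex_curve (F ` sphere 0 r) \<and>
        (\<exists>\<phi>. tangent_arg (\<lambda>\<theta>. F (of_real r * cis \<theta>)) \<phi> \<and>
           (\<forall>\<theta>. 0 \<le> \<theta> \<and> \<theta> < 2 * pi \<longrightarrow>
              (\<exists>d. (\<phi> has_real_derivative d) (at \<theta>) \<and> d > \<alpha>))))"

abbreviation fully_convex :: "(complex \<Rightarrow> complex) \<Rightarrow> bool" where
  "fully_convex F \<equiv> fully_convex_of_order 0 F"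

definition rescale :: "real \<Rightarrow> (complex \<Rightarrow> complex) \<Rightarrow> complex \<Rightarrow> complex" where
  "rescale r F z = F (of_real r * z) / of_real r"

text \<open>The data \<open>f = h + cnj g\<close> with \<open>h z = z + (\<Sum>n\<ge>2. a n * z ^ n)\<close>,
  \<open>g z = (\<Sum>n\<ge>2. b n * z ^ n)\<close>, and the coefficient bounds. The values of \<open>a\<close> and \<open>b\<close>
  at \<open>0\<close> and \<open>1\<close> are irrelevant.\<close>

definition coeff_bounded_harmonic :: "(complex \<Rightarrow> complex) \<Rightarrow> bool" where
  "coeff_bounded_harmonic f \<longleftrightarrow> (\<exists>h g. \<exists>a b :: nat \<Rightarrow> complex.
     harmonic_decomp f h g \<and>
     (\<forall>z\<in>unit_disc. (\<lambda>n. a (n + 2) * z ^ (n + 2)) sums (h z - z)) \<and>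
     (\<forall>z\<in>unit_disc. (\<lambda>n. b (n + 2) * z ^ (n + 2)) sums g z) \<and>
     (\<forall>n\<ge>2. norm (a n) \<le> (2 * real n + 1) * (real n + 1) / 6 \<and>
             norm (b n) \<le> (2 * real n - 1) * (real n - 1) / 6 \<and>
             \<bar>norm (a n) - norm (b n)\<bar> \<le> real n))"

lemma D_op_harmonic_decomp:
  assumes "harmonic_decomp f h g" and z: "z \<in> unit_disc"
  shows "D_op \<epsilon> f z = z * deriv h z - \<epsilon> * cnj (z * deriv g z)"
proof -
  have h: "(h has_derivative (\<lambda>w. deriv h z * w)) (at z)"
    and g: "(g has_derivative (\<lambda>w. deriv g z * w)) (at z)"
    using assms holomorphic_derivI[of _ unit_disc z]
    unfolding harmonic_decomp_def has_field_derivative_def by auto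
  have "((\<lambda>w. h w + cnj (g w)) has_derivative
          (\<lambda>w. deriv h z * w + cnj (deriv g z * w))) (at z)"
    by (intro has_derivative_add h has_derivative_cnj g)
  then have "(f has_derivative (\<lambda>w. deriv h z * w + cnj (deriv g z * w))) (at z)"
    by (rule has_derivative_transform_within_open[OF _ open_ball z])
       (use assms in \<open>auto simp: harmonic_decomp_def\<close>)
  then have "frechet_derivative f (at z) = (\<lambda>w. deriv h z * w + cnj (deriv g z * w))"
    by (rule frechet_derivative_at[symmetric])
  then show ?thesis
    unfolding D_op_def wirtinger_z_def wirtinger_zbar_def
    by (simp add: algebra_simps)
qed

end

theory Submission
  imports Defs
begin

text \<open>
  After rescaling, the function in question is \<open>F z = z + (\<Sum>n\<ge>2. A n * z ^ n) + cnj (\<Sum>n\<ge>2. B n * z ^ n)\<close>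
  with \<open>norm (A n) = n * norm (a n) * r ^ (n - 1)\<close> and \<open>norm (B n) = n * norm (b n) * r ^ (n - 1)\<close>.
  The proof rests on the coefficient condition
  \<open>(\<Sum>n\<ge>2. n * (n - \<alpha>) * norm (A n) + n * (n + \<alpha>) * norm (B n)) \<le> 1 - \<alpha>\<close>, which is shown to
  force full convexity of order \<open>\<alpha>\<close> (\<open>fully_convex_harm\<close>). Because \<open>n - \<alpha> > 0\<close>, the left side is
  largest when both coefficient bounds are attained; the sum is then a rational function of \<open>r\<close>, and the
  condition becomes nonnegativity of the polynomial in the statement (\<open>extremal_weight_sums\<close>).

  Let \<open>D w = w * F_z w - cnj w * F_zbar w\<close>. The tangent of the image of a circle at \<open>F w\<close> is
  \<open>\<i> * D w\<close>, so \<open>D w\<close> is the outward normal. The central estimate (\<open>supporting_halfplane\<close>) is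
  \<open>Re ((F w - F z) * cnj (D w)) > 0\<close> for \<open>norm z \<le> norm w\<close>, \<open>z \<noteq> w\<close>. With \<open>z = w * \<zeta>\<close>, expand every
  \<open>\<zeta> ^ n\<close> to first order at \<open>\<zeta> = 1\<close>: the linear part is \<open>s * X + cnj s * Y\<close> with \<open>s = 1 - \<zeta>\<close> and
  \<open>D w = X - Y\<close>, and its pairing with \<open>X - Y\<close> is exactly \<open>Re s * (norm X ^ 2 - norm Y ^ 2)\<close>. Since
  \<open>norm s ^ 2 \<le> 2 * Re s\<close> on the closed disc, this absorbs the quadratic remainder as soon as
  \<open>(\<Sum>n\<ge>2. n ^ 2 * (norm (A n) + norm (B n))) \<le> 1\<close>, which follows from the coefficient condition.
  The one inequality gives both injectivity and, for each circle, a strict supporting line at every image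
  point. The image of the disc is therefore relatively open and closed in an intersection of open
  half-planes, hence equal to it, hence convex (\<open>convex_curve_if_supported\<close>).

  The tangent turns at the rate \<open>Re (N / D)\<close> with \<open>\<partial>D / \<partial>\<theta> = \<i> * N\<close>. It exceeds \<open>\<alpha>\<close> exactly when
  \<open>norm (N - (1 + \<alpha>) * D) < norm (N - (\<alpha> - 1) * D)\<close>, and estimating the two sides term by term leads
  to the coefficient condition once more (\<open>turn_gt\<close>).

  For sharpness, choose both coefficient bounds attained, \<open>a n < 0\<close> and \<open>b n\<close> a positive multiple of
  \<open>\<epsilon>\<close>. Then \<open>A n\<close> and \<open>B n\<close> are negative and on the positive axis \<open>N - \<alpha> * D\<close> is a positive
  multiple of the radius polynomial, which is negative beyond its root. If the function were fully convex there,
  continuity would give \<open>D > 0\<close> on the axis, and then the rate of turning would be below \<open>\<alpha>\<close>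
  (\<open>real_axis_criterion\<close>).
\<close>

section \<open>Power series on the unit disc\<close>

definition psum :: "(nat \<Rightarrow> 'a::{real_normed_field,banach}) \<Rightarrow> 'a \<Rightarrow> 'a" where
  "psum c z = (\<Sum>n. c n * z ^ n)"

definition conv_disc :: "(nat \<Rightarrow> 'a::{real_normed_field,banach}) \<Rightarrow> bool" where
  "conv_disc c \<longleftrightarrow> (\<forall>z. norm z < 1 \<longrightarrow> summable (\<lambda>n. c n * z ^ n))"

text \<open>The coefficients of \<open>z * f' z\<close>; on circles, \<open>\<i>\<close> times this operation is \<open>\<partial> / \<partial>\<theta>\<close>.\<close>
definition euler :: "(nat \<Rightarrow> 'a::{real_normed_field,banach}) \<Rightarrow> nat \<Rightarrow> 'a" where
  "euler c n = of_nat n * c n"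

lemma psum_sums: "conv_disc c \<Longrightarrow> norm z < 1 \<Longrightarrow> (\<lambda>n. c n * z ^ n) sums psum c z"
  by (simp add: conv_disc_def psum_def summable_sums)

lemma psum_euler:
  assumes "conv_disc c" "norm z < 1"
  shows "(psum c has_field_derivative psum (diffs c) z) (at z)"
    and "(\<lambda>n. euler c n * z ^ n) sums (z * psum (diffs c) z)"
    and "psum (euler c) z = z * psum (diffs c) z"
proof -
  have s: "\<And>z. norm z < 1 \<Longrightarrow> summable (\<lambda>n. c n * z ^ n)"
    using assms(1) by (simp add: conv_disc_def)
  show "(psum c has_field_derivative psum (diffs c) z) (at z)"
    unfolding psum_def[abs_def] by (rule termdiffs_strong'[OF s assms(2)])
  have "summable (\<lambda>n. diffs c n * z ^ n)"
    by (rule termdiff_converges[OF assms(2) s])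
  from sums_mult[OF diffs_equiv[OF this], of z]
  have "(\<lambda>n. z * (of_nat n * c n * z ^ (n - Suc 0))) sums (z * psum (diffs c) z)"
    by (simp add: psum_def)
  also have "(\<lambda>n. z * (of_nat n * c n * z ^ (n - Suc 0))) = (\<lambda>n. euler c n * z ^ n)"
  proof
    fix n show "z * (of_nat n * c n * z ^ (n - Suc 0)) = euler c n * z ^ n"
      by (cases n) (simp_all add: euler_def)
  qed
  finally show e: "(\<lambda>n. euler c n * z ^ n) sums (z * psum (diffs c) z)" .
  show "psum (euler c) z = z * psum (diffs c) z"
    using sums_unique[OF e] by (simp add: psum_def)
qed

lemma conv_disc_euler: "conv_disc c \<Longrightarrow> conv_disc (euler c)"
  using psum_euler(2) sums_summable unfolding conv_disc_def by blast

lemma psum_lincomb: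
  assumes "conv_disc c" "conv_disc d" "norm z < 1"
  shows "psum (\<lambda>n. x * c n + y * d n) z = x * psum c z + y * psum d z"
proof -
  have "(\<lambda>n. x * (c n * z ^ n) + y * (d n * z ^ n)) sums (x * psum c z + y * psum d z)"
    by (intro sums_add sums_mult psum_sums assms)
  then have "(\<lambda>n. (x * c n + y * d n) * z ^ n) sums (x * psum c z + y * psum d z)"
    by (simp add: algebra_simps)
  then show ?thesis unfolding psum_def by (rule sums_unique[symmetric])
qed

lemma has_vector_derivative_cis:
  assumes "(\<phi> has_real_derivative d) (at \<theta>)"
  shows "((\<lambda>\<theta>. cis (\<phi> \<theta>)) has_vector_derivative \<i> * of_real d * cis (\<phi> \<theta>)) (at \<theta>)"
proof -
  have "((\<lambda>\<theta>. exp (\<i> * of_real (\<phi> \<theta>))) has_vector_derivative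
      (\<i> * of_real d) * exp (\<i> * of_real (\<phi> \<theta>))) (at \<theta>)"
    using assms
    by (intro field_vector_diff_chain_at[unfolded o_def, where g = exp]
        has_vector_derivative_mult_right has_vector_derivative_of_real DERIV_exp)
      (simp_all add: has_real_derivative_iff_has_vector_derivative)
  then show ?thesis by (simp add: cis_conv_exp)
qed

lemma circle_has_vector_derivative:
  "((\<lambda>\<theta>. of_real r * cis \<theta>) has_vector_derivative \<i> * (of_real r * cis \<theta>)) (at \<theta>)"
  using has_vector_derivative_mult_right[OF has_vector_derivative_cis[OF DERIV_ident], of "of_real r"]
  by (simp add: mult.left_commute)

lemma psum_on_circle:
  assumes "conv_disc c" "0 \<le> r" "r < 1"
  shows "((\<lambda>\<theta>. psum c (of_real r * cis \<theta>)) has_vector_derivative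
           \<i> * psum (euler c) (of_real r * cis \<theta>)) (at \<theta>)"
proof -
  have n: "norm (of_real r * cis \<theta>) < 1" using assms by (simp add: norm_mult)
  from field_vector_diff_chain_at[OF circle_has_vector_derivative psum_euler(1)[OF assms(1) n]]
  show ?thesis unfolding o_def psum_euler(3)[OF assms(1) n] by (simp only: mult.assoc)
qed

text \<open>A series that starts at \<open>z ^ 2\<close> gains the factor \<open>(norm z)\<^sup>2\<close>. This factor makes the inequalities below
  strict inside the disc although the coefficient condition allows equality.\<close>
lemma psum_tail_bound:
  fixes c :: "nat \<Rightarrow> 'a::{real_normed_field,banach}"
  assumes "\<And>n. n < 2 \<Longrightarrow> c n = 0" "\<And>n. norm (c n) \<le> k n" "k sums K" "norm z \<le> 1"
  shows "norm (psum c z) \<le> (norm z)\<^sup>2 * K"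
proof -
  have le: "norm (c n * z ^ n) \<le> (norm z)\<^sup>2 * k n" for n
  proof (cases "n < 2")
    case True
    have "0 \<le> k n" using assms(2)[of n] norm_ge_zero order_trans by blast
    then show ?thesis using True assms(1) by simp
  next
    case False
    have "norm (c n) * norm z ^ n \<le> k n * (norm z)\<^sup>2"
      using False assms(4) order_trans[OF norm_ge_zero assms(2)[of n]]
      by (intro mult_mono assms(2) power_decreasing) auto
    then show ?thesis by (simp add: norm_mult norm_power mult.commute)
  qed
  have s: "(\<lambda>n. (norm z)\<^sup>2 * k n) sums ((norm z)\<^sup>2 * K)" by (intro sums_mult assms)
  show ?thesis
    unfolding psum_def sums_unique[OF s] by (rule norm_suminf_le[OF le sums_summable[OF s]])
qed

section \<open>Inequalities for complex numbers\<close>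

text \<open>With \<open>e n\<close> the remainder on the left, \<open>e (n + 1) = \<zeta> * e n + n * (\<zeta> - 1) ^ 2\<close>, so on the closed
  disc \<open>norm (e n)\<close> is at most \<open>0 + 1 + \<dots> + (n - 1)\<close> times \<open>(norm (\<zeta> - 1))\<^sup>2\<close>.\<close>
lemma norm_power_Taylor_le:
  fixes \<zeta> :: "'a::real_normed_field"
  assumes "norm \<zeta> \<le> 1"
  shows "norm (\<zeta> ^ n - 1 - of_nat n * (\<zeta> - 1)) \<le> (norm (\<zeta> - 1))\<^sup>2 * (real n * (real n - 1) / 2)"
proof (induction n)
  case 0 then show ?case by simp
next
  case (Suc n)
  let ?e = "\<zeta> ^ n - 1 - of_nat n * (\<zeta> - 1)"
  have "\<zeta> ^ Suc n - 1 - of_nat (Suc n) * (\<zeta> - 1) = \<zeta> * ?e + of_nat n * (\<zeta> - 1)\<^sup>2"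
    by (simp add: algebra_simps power2_eq_square)
  then have "norm (\<zeta> ^ Suc n - 1 - of_nat (Suc n) * (\<zeta> - 1))
      \<le> norm \<zeta> * norm ?e + real n * (norm (\<zeta> - 1))\<^sup>2"
    by (metis norm_mult norm_of_nat norm_power norm_triangle_ineq)
  also have "\<dots> \<le> norm ?e + real n * (norm (\<zeta> - 1))\<^sup>2"
    using mult_right_mono[OF assms norm_ge_zero[of ?e]] by simp
  also have "\<dots> \<le> (norm (\<zeta> - 1))\<^sup>2 * (real n * (real n - 1) / 2) + real n * (norm (\<zeta> - 1))\<^sup>2"
    using Suc by simp
  also have "\<dots> = (norm (\<zeta> - 1))\<^sup>2 * (real (Suc n) * (real (Suc n) - 1) / 2)"
    by (simp add: field_simps)
  finally show ?case .
qed

text \<open>The mixed terms of \<open>(s * X + cnj s * Y) * cnj (X - Y)\<close> are a number minus its conjugate, so they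
  vanish in the real part and leave \<open>Re s * ((norm X)\<^sup>2 - (norm Y)\<^sup>2)\<close>. As \<open>Re s\<close> is at least half of
  \<open>(norm s)\<^sup>2\<close>, this dominates the contribution of \<open>E\<close>; one factor \<open>norm X + norm Y \<ge> norm (X - Y)\<close> cancels.\<close>
lemma reflected_pairing_pos:
  fixes X Y E s :: complex
  assumes s: "s \<noteq> 0" "(norm s)\<^sup>2 \<le> 2 * Re s"
    and E: "norm E \<le> (norm s)\<^sup>2 * M" and M: "0 \<le> M" "2 * M < norm X - norm Y"
  shows "Re ((s * X + cnj s * Y - E) * cnj (X - Y)) > 0"
proof -
  have id: "Re ((s * X + cnj s * Y) * cnj (X - Y)) = Re s * ((norm X)\<^sup>2 - (norm Y)\<^sup>2)"
    unfolding cmod_power2 by (simp add: algebra_simps power2_eq_square)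
  have tri: "norm (X - Y) \<le> norm X + norm Y" by (rule norm_triangle_ineq4)
  have pos: "0 < norm (X - Y)" using M norm_triangle_ineq2[of X Y] by linarith
  have s2: "0 < (norm s)\<^sup>2" using s by simp
  have "Re (E * cnj (X - Y)) \<le> norm E * norm (X - Y)"
    using complex_Re_le_cmod[of "E * cnj (X - Y)"] by (simp only: norm_mult complex_mod_cnj)
  also have "\<dots> \<le> (norm s)\<^sup>2 * M * norm (X - Y)" by (intro mult_right_mono E) simp
  also have "\<dots> < (norm s)\<^sup>2 * ((norm X - norm Y) / 2) * norm (X - Y)"
    using M pos s2 by (intro mult_strict_right_mono mult_strict_left_mono) auto
  also have "\<dots> \<le> (norm s)\<^sup>2 * ((norm X - norm Y) / 2) * (norm X + norm Y)"
    using M by (intro mult_left_mono tri) auto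
  also have "\<dots> = (norm s)\<^sup>2 / 2 * ((norm X)\<^sup>2 - (norm Y)\<^sup>2)"
    by (simp add: field_simps power2_eq_square)
  also have "\<dots> \<le> Re s * ((norm X)\<^sup>2 - (norm Y)\<^sup>2)"
    using s M by (intro mult_right_mono) (auto simp: power2_le_iff_abs_le)
  finally show ?thesis using id by (simp add: left_diff_distrib)
qed

text \<open>The quotient \<open>w / v\<close> is closer to \<open>t + 1\<close> than to \<open>t - 1\<close>, hence to the right of the line
  \<open>Re = t\<close>.\<close>
lemma Re_mult_cnj_gt:
  fixes w v :: complex and t :: real
  assumes "norm (w - of_real (1 + t) * v) < norm (w - of_real (t - 1) * v)"
  shows "v \<noteq> 0" "t * (norm v)\<^sup>2 < Re (w * cnj v)"
proof -
  show "v \<noteq> 0" using assms by auto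
  have "(norm (w - of_real (1 + t) * v))\<^sup>2 < (norm (w - of_real (t - 1) * v))\<^sup>2"
    using assms by (intro power_strict_mono) auto
  then show "t * (norm v)\<^sup>2 < Re (w * cnj v)"
    unfolding cmod_power2 by (simp add: algebra_simps power2_eq_square)
qed

section \<open>Tangent and normal along the image of a circle\<close>
locale harmonic_series =
  fixes A B :: "nat \<Rightarrow> complex"
  assumes convA: "conv_disc A" and convB: "conv_disc B"
    and tailA: "n < 2 \<Longrightarrow> A n = 0" and tailB: "n < 2 \<Longrightarrow> B n = 0"
begin

definition harm :: "complex \<Rightarrow> complex" where
  "harm z = z + psum A z + cnj (psum B z)"

text \<open>This is \<open>z * F_z - cnj z * F_zbar\<close>; times \<open>\<i>\<close> it is the tangent \<open>\<partial>F / \<partial>\<theta>\<close> of the image circle.\<close>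
definition normal :: "complex \<Rightarrow> complex" where
  "normal z = z + psum (euler A) z - cnj (psum (euler B) z)"

text \<open>Times \<open>\<i>\<close> this is \<open>\<partial>normal / \<partial>\<theta>\<close>, so the tangent direction turns at the rate
  \<open>Re (turn z / normal z)\<close>.\<close>
definition turn :: "complex \<Rightarrow> complex" where
  "turn z = z + psum (euler (euler A)) z + cnj (psum (euler (euler B)) z)"

lemma harm_on_circle:
  assumes "0 \<le> r" "r < 1"
  shows "((\<lambda>\<theta>. harm (of_real r * cis \<theta>)) has_vector_derivative
           \<i> * normal (of_real r * cis \<theta>)) (at \<theta>)"
proof -
  let ?z = "of_real r * cis \<theta>"
  have "((\<lambda>\<theta>. harm (of_real r * cis \<theta>)) has_vector_derivative
      \<i> * ?z + \<i> * psum (euler A) ?z + cnj (\<i> * psum (euler B) ?z)) (at \<theta>)"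
    unfolding harm_def
    by (intro has_vector_derivative_add has_vector_derivative_cnj psum_on_circle
        circle_has_vector_derivative convA convB assms)
  then show ?thesis by (simp add: normal_def algebra_simps)
qed

lemma normal_on_circle:
  assumes "0 \<le> r" "r < 1"
  shows "((\<lambda>\<theta>. normal (of_real r * cis \<theta>)) has_vector_derivative
           \<i> * turn (of_real r * cis \<theta>)) (at \<theta>)"
proof -
  let ?z = "of_real r * cis \<theta>"
  have "((\<lambda>\<theta>. normal (of_real r * cis \<theta>)) has_vector_derivative
      \<i> * ?z + \<i> * psum (euler (euler A)) ?z - cnj (\<i> * psum (euler (euler B)) ?z)) (at \<theta>)"
    unfolding normal_def
    by (intro has_vector_derivative_add has_vector_derivative_diff has_vector_derivative_cnj
        psum_on_circle conv_disc_euler circle_has_vector_derivative convA convB assms)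
  then show ?thesis by (simp add: turn_def algebra_simps)
qed

lemma turn_minus_normal:
  assumes "norm z < 1"
  shows "turn z - of_real s * normal z = of_real (1 - s) * z
     + psum (\<lambda>n. of_real ((real n)\<^sup>2 - s * real n) * A n) z
     + cnj (psum (\<lambda>n. of_real ((real n)\<^sup>2 + s * real n) * B n) z)"
proof -
  have "(\<lambda>n. of_real ((real n)\<^sup>2 - s * real n) * A n)
      = (\<lambda>n. 1 * euler (euler A) n + (- of_real s) * euler A n)"
    by (simp add: fun_eq_iff euler_def power2_eq_square algebra_simps)
  moreover have "(\<lambda>n. of_real ((real n)\<^sup>2 + s * real n) * B n)
      = (\<lambda>n. 1 * euler (euler B) n + of_real s * euler B n)"
    by (simp add: fun_eq_iff euler_def power2_eq_square algebra_simps)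
  ultimately show ?thesis
    using assms
    by (simp only: psum_lincomb conv_disc_euler convA convB)
      (simp add: turn_def normal_def algebra_simps)
qed

text \<open>The Taylor expansion in \<open>\<zeta>\<close> at \<open>1\<close>: the linear part has the shape that
  \<open>reflected_pairing_pos\<close> needs, with \<open>X - Y = normal w\<close>.\<close>
lemma harm_diff:
  assumes "norm w < 1" "norm \<zeta> \<le> 1"
  shows "harm w - harm (w * \<zeta>) =
     (1 - \<zeta>) * (w + psum (euler A) w) + cnj (1 - \<zeta>) * cnj (psum (euler B) w)
     - (psum (\<lambda>n. A n * (\<zeta> ^ n - 1 - of_nat n * (\<zeta> - 1))) w
        + cnj (psum (\<lambda>n. B n * (\<zeta> ^ n - 1 - of_nat n * (\<zeta> - 1))) w))"
proof -
  have wz: "norm (w * \<zeta>) < 1"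
  proof -
    have "norm w * norm \<zeta> \<le> norm w * 1" by (intro mult_left_mono assms) simp
    with assms(1) show ?thesis by (simp add: norm_mult)
  qed
  have *: "psum (\<lambda>n. c n * (\<zeta> ^ n - 1 - of_nat n * (\<zeta> - 1))) w
      = psum c (w * \<zeta>) - psum c w - (\<zeta> - 1) * psum (euler c) w" if "conv_disc c" for c
  proof -
    have "(\<lambda>n. c n * (w * \<zeta>) ^ n - c n * w ^ n - (\<zeta> - 1) * (euler c n * w ^ n))
        sums (psum c (w * \<zeta>) - psum c w - (\<zeta> - 1) * psum (euler c) w)"
      by (intro sums_diff sums_mult psum_sums wz assms conv_disc_euler that)
    also have "(\<lambda>n. c n * (w * \<zeta>) ^ n - c n * w ^ n - (\<zeta> - 1) * (euler c n * w ^ n))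
        = (\<lambda>n. c n * (\<zeta> ^ n - 1 - of_nat n * (\<zeta> - 1)) * w ^ n)"
      by (simp add: fun_eq_iff euler_def power_mult_distrib algebra_simps)
    finally show ?thesis unfolding psum_def by (rule sums_unique[symmetric])
  qed
  show ?thesis unfolding *[OF convA] *[OF convB] harm_def
    by (simp add: algebra_simps)
qed

text \<open>Any continuous argument of the tangent, once differentiable at a point, has the expected derivative
  there: \<open>\<i> * normal * cis (- \<phi>)\<close> is real along the curve, and so is its derivative.\<close>
lemma turning_rate:
  assumes r: "0 \<le> r" "r < 1" and ta: "tangent_arg (\<lambda>\<theta>. harm (of_real r * cis \<theta>)) \<phi>"
    and d: "(\<phi> has_real_derivative d) (at \<theta>)"
  defines "z \<equiv> of_real r * cis \<theta>"
  shows "normal z \<noteq> 0" "Re (turn z * cnj (normal z)) = d * (norm (normal z))\<^sup>2"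
proof -
  have pol: "normal (of_real r * cis t) \<noteq> 0 \<and>
      \<i> * normal (of_real r * cis t) = of_real (norm (normal (of_real r * cis t))) * cis (\<phi> t)" for t
  proof -
    obtain v where v: "((\<lambda>\<theta>. harm (of_real r * cis \<theta>)) has_vector_derivative v) (at t)"
      "v \<noteq> 0" "v = of_real (norm v) * cis (\<phi> t)"
      using ta unfolding tangent_arg_def by blast
    have "v = \<i> * normal (of_real r * cis t)"
      by (rule vector_derivative_unique_at[OF v(1) harm_on_circle[OF r]])
    with v(2,3) show ?thesis by (auto simp: norm_mult)
  qed
  show "normal z \<noteq> 0" using pol[of \<theta>] by (simp add: z_def)
  have zero: "Im (\<i> * normal (of_real r * cis t) * cis (- \<phi> t)) = 0" for t
    by (subst conjunct2[OF pol[of t]]) (simp add: cis_mult mult.assoc)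
  have cis: "((\<lambda>t. cis (- \<phi> t)) has_vector_derivative - of_real d * \<i> * cis (- \<phi> \<theta>)) (at \<theta>)"
    using has_vector_derivative_cis[OF DERIV_minus[OF d]] by (simp add: mult.commute)
  have "((\<lambda>t. Im (\<i> * normal (of_real r * cis t) * cis (- \<phi> t))) has_vector_derivative
     Im (\<i> * normal z * (- of_real d * \<i> * cis (- \<phi> \<theta>)) + \<i> * (\<i> * turn z) * cis (- \<phi> \<theta>))) (at \<theta>)"
    unfolding z_def
    by (intro bounded_linear.has_vector_derivative[OF bounded_linear_Im]
        has_vector_derivative_mult has_vector_derivative_mult_right normal_on_circle r cis)
  moreover have "((\<lambda>t. Im (\<i> * normal (of_real r * cis t) * cis (- \<phi> t))) has_vector_derivative 0) (at \<theta>)"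
    unfolding zero by simp
  ultimately have "Im (\<i> * normal z * (- of_real d * \<i> * cis (- \<phi> \<theta>)) + \<i> * (\<i> * turn z) * cis (- \<phi> \<theta>)) = 0"
    by (rule vector_derivative_unique_at)
  then have e: "Im (turn z * cis (- \<phi> \<theta>)) = d * Im (normal z * cis (- \<phi> \<theta>))"
    by (simp add: algebra_simps)
  define m where "m = norm (normal z)"
  have "normal z = - \<i> * (\<i> * normal z)" by simp
  also have "\<i> * normal z = of_real m * cis (\<phi> \<theta>)"
    using pol[of \<theta>] by (simp add: z_def m_def)
  finally have n: "normal z = - \<i> * (of_real m * cis (\<phi> \<theta>))" .
  have "normal z * cis (- \<phi> \<theta>) = - \<i> * of_real m"
    unfolding n by (simp add: cis_mult mult.assoc)
  then have 1: "Im (turn z * cis (- \<phi> \<theta>)) = - d * m" using e by simp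
  have "cnj (normal z) = \<i> * (of_real m * cis (- \<phi> \<theta>))"
    unfolding n by (simp add: cis_cnj)
  then have "Re (turn z * cnj (normal z)) = Re (turn z * (\<i> * (of_real m * cis (- \<phi> \<theta>))))"
    by (simp only:)
  also have "\<dots> = - (m * Im (turn z * cis (- \<phi> \<theta>)))"
    by (simp add: algebra_simps)
  finally show "Re (turn z * cnj (normal z)) = d * (norm (normal z))\<^sup>2"
    unfolding 1 m_def[symmetric] by (simp add: power2_eq_square)
qed

end

section \<open>A coefficient condition for full convexity\<close>
definition moment :: "(nat \<Rightarrow> complex) \<Rightarrow> nat \<Rightarrow> real" where
  "moment c k = (\<Sum>n. real n ^ k * norm (c n))"

text \<open>Let \<open>O'\<close> be the intersection of the open half-planes bounded by the supporting lines. The boundary curve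
  misses \<open>O'\<close>, so the open set \<open>K = F ` ball 0 r\<close> is also closed in \<open>O'\<close>; as \<open>O'\<close> is convex, it is
  connected, and \<open>K = O'\<close>. Openness of \<open>K\<close> is invariance of domain.\<close>
lemma convex_curve_if_supported:
  fixes F D :: "complex \<Rightarrow> complex"
  assumes r: "0 < r" and cont: "continuous_on (cball 0 r) F" and inj: "inj_on F (cball 0 r)"
    and sup: "\<And>w z. norm w = r \<Longrightarrow> norm z < r \<Longrightarrow> Re ((F w - F z) * cnj (D w)) > 0"
  shows "convex_curve (F ` sphere 0 r)"
proof -
  define K where "K = F ` ball 0 r"
  define O' where "O' = (\<Inter>w\<in>sphere 0 r. {x. D w \<bullet> x < D w \<bullet> F w})"
  have opK: "open K"
    unfolding K_def
    by (rule invariance_of_domain)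
      (use cont inj in \<open>auto intro: continuous_on_subset inj_on_subset\<close>)
  have ne: "K \<noteq> {}" using r by (simp add: K_def)
  have comp: "compact (F ` cball 0 r)"
    by (rule compact_continuous_image[OF cont compact_cball])
  have split: "F ` cball 0 r = K \<union> F ` sphere 0 r"
    unfolding K_def by (auto simp: image_iff cball_def ball_def sphere_def) force
  have disj: "K \<inter> F ` sphere 0 r = {}"
    using inj unfolding K_def inj_on_def by fastforce
  have clK: "closure K = F ` cball 0 r"
  proof
    show "closure K \<subseteq> F ` cball 0 r"
      using compact_imp_closed[OF comp] split by (intro closure_minimal) auto
    have "F ` closure (ball 0 r) \<subseteq> closure K"
      unfolding K_def using cont r
      by (intro image_closure_subset) (auto simp: closure_subset)
    then show "F ` cball 0 r \<subseteq> closure K" using r by simp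
  qed
  have dot: "Re ((p - q) * cnj v) > 0 \<longleftrightarrow> v \<bullet> q < v \<bullet> p" for p q v :: complex
    by (simp add: inner_complex_def algebra_simps)
  have KO: "K \<subseteq> O'"
    using sup[unfolded dot] unfolding K_def O'_def by auto
  have "convex O'" unfolding O'_def by (intro convex_INT convex_halfspace_lt)
  then have "connected O'" by (rule convex_connected)
  moreover have "openin (top_of_set O') K" using opK KO by (simp add: open_subset)
  moreover have "K = O' \<inter> closure K"
    using KO closure_subset unfolding clK split by (auto simp: O'_def)
  then have "closedin (top_of_set O') K" by (metis closed_closure closedin_closed)
  ultimately have "K = O'" using ne by (metis connected_clopen)
  have "frontier K = F ` sphere 0 r"
    unfolding frontier_def clK split interior_open[OF opK] using disj by auto
  moreover have "bounded K"
    using compact_imp_bounded[OF comp] split by (auto intro: bounded_subset)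
  ultimately show ?thesis
    unfolding convex_curve_def using ne opK \<open>convex O'\<close> \<open>K = O'\<close> by blast
qed

lemma moment_sums_tail:
  fixes c :: "nat \<Rightarrow> complex"
  assumes t: "\<And>n. n < 2 \<Longrightarrow> c n = 0" and s: "summable (\<lambda>n. real n ^ 2 * norm (c n))"
  shows "k \<le> 2 \<Longrightarrow> (\<lambda>n. real n ^ k * norm (c n)) sums moment c k"
    and "0 \<le> moment c 1" and "moment c 1 \<le> moment c 2" and "conv_disc c"
proof -
  have le: "real n ^ k * norm (c n) \<le> real n ^ 2 * norm (c n)" if "k \<le> 2" for n k
    using t[of n] that by (cases "n < 2") (auto intro!: mult_right_mono power_increasing)
  have sm: "summable (\<lambda>n. real n ^ k * norm (c n))" if "k \<le> 2" for k
    by (rule summable_comparison_test[OF _ s]) (use le[OF that] in auto)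
  then show "k \<le> 2 \<Longrightarrow> (\<lambda>n. real n ^ k * norm (c n)) sums moment c k"
    unfolding moment_def by (intro summable_sums)
  show "0 \<le> moment c 1" unfolding moment_def by (intro suminf_nonneg sm) auto
  show "moment c 1 \<le> moment c 2" unfolding moment_def by (intro suminf_le le sm) auto
  show "conv_disc c" unfolding conv_disc_def
  proof (intro allI impI)
    fix z :: complex assume "norm z < 1"
    then have "norm (c n * z ^ n) \<le> real n ^ 0 * norm (c n)" for n
      by (simp add: norm_mult norm_power power_le_one mult_left_le)
    then show "summable (\<lambda>n. c n * z ^ n)"
      by (intro summable_comparison_test[OF _ sm[of 0]]) auto
  qed
qed

lemma psum_euler_bound:
  fixes c :: "nat \<Rightarrow> complex"
  assumes "\<And>n. n < 2 \<Longrightarrow> c n = 0" "summable (\<lambda>n. real n ^ 2 * norm (c n))" "norm z \<le> 1"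
  shows "norm (psum (euler c) z) \<le> (norm z)\<^sup>2 * moment c 1"
  using moment_sums_tail(1)[OF assms(1,2), of 1] assms(1,3)
  by (intro psum_tail_bound[where k = "\<lambda>n. real n ^ 1 * norm (c n)"])
    (auto simp: euler_def norm_mult)

text \<open>The condition \<open>weight\<close> is
  \<open>(\<Sum>n\<ge>2. n * (n - \<alpha>) * norm (A n) + n * (n + \<alpha>) * norm (B n)) \<le> 1 - \<alpha>\<close>. Written with moments, it
  makes every estimate below a linear combination of four numbers.\<close>
locale convex_harmonic_series =
  fixes \<alpha> :: real and A B :: "nat \<Rightarrow> complex"
  assumes \<alpha>: "0 \<le> \<alpha>" "\<alpha> < 1"
    and tA: "\<And>n. n < 2 \<Longrightarrow> A n = 0" and tB: "\<And>n. n < 2 \<Longrightarrow> B n = 0"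
    and sumA: "summable (\<lambda>n. real n ^ 2 * norm (A n))"
    and sumB: "summable (\<lambda>n. real n ^ 2 * norm (B n))"
    and weight: "moment A 2 - \<alpha> * moment A 1 + moment B 2 + \<alpha> * moment B 1 \<le> 1 - \<alpha>"
begin

lemmas mA = moment_sums_tail[OF tA sumA]
lemmas mB = moment_sums_tail[OF tB sumB]

sublocale harmonic_series A B
  by unfold_locales (use mA(4) mB(4) tA tB in auto)

text \<open>Here \<open>moment A 1 \<le> moment A 2\<close> is used: it gives
  \<open>moment A 2 - \<alpha> * moment A 1 \<ge> (1 - \<alpha>) * moment A 2\<close>.\<close>
lemma weight_convex: "moment A 2 + moment B 2 \<le> 1"
proof -
  have "(1 - \<alpha>) * (moment A 2 + moment B 2) \<le> moment A 2 - \<alpha> * moment A 1 + moment B 2 + \<alpha> * moment B 1"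
    using mult_left_mono[OF mA(3) \<alpha>(1)] mult_nonneg_nonneg[OF \<alpha>(1) mB(2)]
      mult_nonneg_nonneg[OF \<alpha>(1) order_trans[OF mB(2) mB(3)]] by (simp add: algebra_simps)
  also have "\<dots> \<le> 1 - \<alpha>" by (rule weight)
  finally show ?thesis using \<alpha> by (simp add: mult_le_cancel_left1)
qed

text \<open>Up to the factor \<open>(norm (1 - \<zeta>))\<^sup>2\<close>, the left side is twice the bound for the quadratic Taylor
  remainder in \<open>supporting_halfplane\<close>; it is nonnegative, so the Jacobian is positive too.\<close>
lemma analytic_dominates:
  assumes "z \<noteq> 0" "norm z < 1"
  shows "(norm z)\<^sup>2 * (moment A 2 - moment A 1 + (moment B 2 - moment B 1))
    < norm (z + psum (euler A) z) - norm (psum (euler B) z)"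
proof -
  have 1: "norm (psum (euler A) z) \<le> (norm z)\<^sup>2 * moment A 1"
    "norm (psum (euler B) z) \<le> (norm z)\<^sup>2 * moment B 1"
    using assms by (intro psum_euler_bound tA tB sumA sumB; simp)+
  have "(norm z)\<^sup>2 * (moment A 2 + moment B 2) \<le> (norm z)\<^sup>2"
    using weight_convex by (simp add: mult_left_le)
  also have "\<dots> < norm z" using assms by (simp add: power2_eq_square)
  finally have 2: "(norm z)\<^sup>2 * (moment A 2 + moment B 2) < norm z" .
  have "norm z - norm (psum (euler A) z) \<le> norm (z + psum (euler A) z)"
    by (metis norm_diff_ineq)
  with 1 2 show ?thesis by (simp add: algebra_simps)
qed

lemma supporting_halfplane:
  assumes w: "w \<noteq> 0" "norm w < 1" and z: "norm z \<le> norm w" "z \<noteq> w"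
  shows "Re ((harm w - harm z) * cnj (normal w)) > 0"
proof -
  define \<zeta> where "\<zeta> = z / w"
  define M where "M = (norm w)\<^sup>2 * ((moment A 2 - moment A 1 + (moment B 2 - moment B 1)) / 2)"
  define X where "X = w + psum (euler A) w"
  define Y where "Y = cnj (psum (euler B) w)"
  define E where "E c = psum (\<lambda>n. c n * (\<zeta> ^ n - 1 - of_nat n * (\<zeta> - 1))) w" for c
  have zw: "z = w * \<zeta>" and \<zeta>: "norm \<zeta> \<le> 1" "\<zeta> \<noteq> 1"
    using w z by (auto simp: \<zeta>_def norm_divide)
  have E: "norm (E c) \<le> (norm w)\<^sup>2 * ((norm (1 - \<zeta>))\<^sup>2 * ((moment c 2 - moment c 1) / 2))"
    if t: "\<And>n. n < 2 \<Longrightarrow> c n = 0" and s: "summable (\<lambda>n. real n ^ 2 * norm (c n))" for c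
    unfolding E_def
  proof (rule psum_tail_bound)
    show "(\<lambda>n. (norm (1 - \<zeta>))\<^sup>2 * ((real n ^ 2 * norm (c n) - real n ^ 1 * norm (c n)) / 2))
        sums ((norm (1 - \<zeta>))\<^sup>2 * ((moment c 2 - moment c 1) / 2))"
      by (intro sums_mult sums_divide sums_diff moment_sums_tail[OF t s]) auto
    show "norm (c n * (\<zeta> ^ n - 1 - of_nat n * (\<zeta> - 1)))
        \<le> (norm (1 - \<zeta>))\<^sup>2 * ((real n ^ 2 * norm (c n) - real n ^ 1 * norm (c n)) / 2)" for n
    proof -
      have "norm (c n * (\<zeta> ^ n - 1 - of_nat n * (\<zeta> - 1)))
          \<le> norm (c n) * ((norm (\<zeta> - 1))\<^sup>2 * (real n * (real n - 1) / 2))"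
        unfolding norm_mult by (intro mult_left_mono norm_power_Taylor_le \<zeta>) simp
      also have "norm (\<zeta> - 1) = norm (1 - \<zeta>)" by (rule norm_minus_commute)
      finally show ?thesis by (simp add: field_simps power2_eq_square)
    qed
  qed (use w t in auto)
  have "Re (((1 - \<zeta>) * X + cnj (1 - \<zeta>) * Y - (E A + cnj (E B))) * cnj (X - Y)) > 0"
  proof (rule reflected_pairing_pos)
    show "1 - \<zeta> \<noteq> 0" using \<zeta> by simp
    have "(norm \<zeta>)\<^sup>2 \<le> 1" using \<zeta> by (simp add: power_le_one)
    then show "(norm (1 - \<zeta>))\<^sup>2 \<le> 2 * Re (1 - \<zeta>)"
      unfolding cmod_power2 by (simp add: power2_eq_square algebra_simps)
    have "norm (E A + cnj (E B)) \<le> norm (E A) + norm (E B)"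
      by (metis complex_mod_cnj norm_triangle_ineq)
    with E[OF tA sumA] E[OF tB sumB] show "norm (E A + cnj (E B)) \<le> (norm (1 - \<zeta>))\<^sup>2 * M"
      by (simp add: M_def algebra_simps add_divide_distrib diff_divide_distrib)
    show "0 \<le> M" unfolding M_def using mA(3) mB(3) by simp
    show "2 * M < norm X - norm Y"
      using analytic_dominates[OF w] by (simp add: M_def X_def Y_def)
  qed
  then show ?thesis
    unfolding zw harm_diff[OF w(2) \<zeta>(1)] by (simp add: X_def Y_def E_def normal_def)
qed

text \<open>Thus \<open>normal z / z\<close> stays in the right half-plane, where the principal logarithm supplies a continuous
  argument along the whole circle.\<close>
lemma normal_near_radius:
  assumes "norm z < 1" "z \<noteq> 0"
  shows "norm (normal z / z - 1) < 1"
proof -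
  have "norm (normal z - z) \<le> norm (psum (euler A) z) + norm (psum (euler B) z)"
    unfolding normal_def using norm_triangle_ineq4[of "psum (euler A) z" "cnj (psum (euler B) z)"] by simp
  also have "\<dots> \<le> (norm z)\<^sup>2 * moment A 1 + (norm z)\<^sup>2 * moment B 1"
    using assms by (intro add_mono psum_euler_bound tA tB sumA sumB) auto
  also have "\<dots> = (norm z)\<^sup>2 * (moment A 1 + moment B 1)" by (simp add: algebra_simps)
  also have "\<dots> \<le> (norm z)\<^sup>2 * 1"
    using weight_convex mA(3) mB(3) by (intro mult_left_mono) auto
  also have "\<dots> < norm z" using assms by (simp add: power2_eq_square)
  finally have "norm ((normal z - z) / z) < 1" using assms by (simp add: norm_divide)
  then show ?thesis using assms by (simp add: diff_divide_distrib)
qed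

text \<open>Both \<open>turn - (1 + \<alpha>) * normal\<close> and \<open>turn - (\<alpha> - 1) * normal\<close> are a multiple of \<open>z\<close> plus a tail. The
  leading moduli \<open>\<alpha> * norm z\<close> and \<open>(2 - \<alpha>) * norm z\<close> differ by \<open>2 * (1 - \<alpha>) * norm z\<close>, and the bounds for
  the tails add up to exactly twice the weight of the coefficients.\<close>
lemma turn_gt:
  assumes z: "norm z < 1" "z \<noteq> 0"
  shows "normal z \<noteq> 0" and "\<alpha> * (norm (normal z))\<^sup>2 < Re (turn z * cnj (normal z))"
proof -
  have rest: "norm (turn z - of_real s * normal z - of_real (1 - s) * z)
      \<le> (norm z)\<^sup>2 * (moment A 2 - s * moment A 1 + moment B 2 + s * moment B 1)"
    if s: "\<bar>s\<bar> \<le> 2" for s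
  proof -
    \<comment> \<open>the coefficients start at \<open>n = 2\<close>, which is why \<open>s\<close> may be as large as \<open>1 + \<alpha>\<close>\<close>
    have pos: "0 \<le> (real n)\<^sup>2 - s * real n" "0 \<le> (real n)\<^sup>2 + s * real n" if "2 \<le> n" for n
    proof -
      have "\<bar>s\<bar> * real n \<le> real n * real n" using s that by (intro mult_right_mono) auto
      then have "\<bar>s * real n\<bar> \<le> (real n)\<^sup>2" by (simp add: abs_mult power2_eq_square)
      then show "0 \<le> (real n)\<^sup>2 - s * real n" "0 \<le> (real n)\<^sup>2 + s * real n" by linarith+
    qed
    have "norm (psum (\<lambda>n. of_real ((real n)\<^sup>2 - s * real n) * A n) z)
        \<le> (norm z)\<^sup>2 * (moment A 2 - s * moment A 1)"
    proof (rule psum_tail_bound)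
      show "(\<lambda>n. real n ^ 2 * norm (A n) - s * (real n ^ 1 * norm (A n))) sums (moment A 2 - s * moment A 1)"
        by (intro sums_diff sums_mult mA) auto
      show "norm (of_real ((real n)\<^sup>2 - s * real n) * A n)
          \<le> real n ^ 2 * norm (A n) - s * (real n ^ 1 * norm (A n))" for n
        unfolding norm_mult norm_of_real using tA[of n] pos(1)[of n] by (cases "n < 2") (auto simp: algebra_simps)
    qed (use z tA in auto)
    moreover have "norm (psum (\<lambda>n. of_real ((real n)\<^sup>2 + s * real n) * B n) z)
        \<le> (norm z)\<^sup>2 * (moment B 2 + s * moment B 1)"
    proof (rule psum_tail_bound)
      show "(\<lambda>n. real n ^ 2 * norm (B n) + s * (real n ^ 1 * norm (B n))) sums (moment B 2 + s * moment B 1)"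
        by (intro sums_add sums_mult mB) auto
      show "norm (of_real ((real n)\<^sup>2 + s * real n) * B n)
          \<le> real n ^ 2 * norm (B n) + s * (real n ^ 1 * norm (B n))" for n
        unfolding norm_mult norm_of_real using tB[of n] pos(2)[of n] by (cases "n < 2") (auto simp: algebra_simps)
    qed (use z tB in auto)
    moreover have "norm (p + cnj q) \<le> norm p + norm q" for p q
      by (metis complex_mod_cnj norm_triangle_ineq)
    ultimately show ?thesis
      unfolding turn_minus_normal[OF z(1)] by (simp add: algebra_simps) (smt (verit))
  qed
  let ?m = "\<lambda>s. moment A 2 - s * moment A 1 + moment B 2 + s * moment B 1"
  have small: "norm (turn z - of_real (1 + \<alpha>) * normal z) \<le> \<alpha> * norm z + (norm z)\<^sup>2 * ?m (1 + \<alpha>)"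
    using rest[of "1 + \<alpha>"] \<alpha> norm_triangle_sub[of "turn z - of_real (1 + \<alpha>) * normal z" "of_real (1 - (1 + \<alpha>)) * z"]
    unfolding norm_mult norm_of_real by simp
  have large: "(2 - \<alpha>) * norm z - (norm z)\<^sup>2 * ?m (\<alpha> - 1) \<le> norm (turn z - of_real (\<alpha> - 1) * normal z)"
    using rest[of "\<alpha> - 1"] \<alpha> norm_triangle_sub[of "of_real (1 - (\<alpha> - 1)) * z" "turn z - of_real (\<alpha> - 1) * normal z"]
    unfolding norm_mult norm_of_real by (simp add: norm_minus_commute)
  have "(norm z)\<^sup>2 * (?m (1 + \<alpha>) + ?m (\<alpha> - 1)) \<le> (norm z)\<^sup>2 * (2 * (1 - \<alpha>))"
    using weight by (intro mult_left_mono) (auto simp: algebra_simps)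
  also have "\<dots> < norm z * (2 * (1 - \<alpha>))"
    using z \<alpha> by (intro mult_strict_right_mono) (auto simp: power2_eq_square)
  finally have "norm (turn z - of_real (1 + \<alpha>) * normal z) < norm (turn z - of_real (\<alpha> - 1) * normal z)"
    using small large by (simp add: algebra_simps)
  from Re_mult_cnj_gt[OF this]
  show "normal z \<noteq> 0" "\<alpha> * (norm (normal z))\<^sup>2 < Re (turn z * cnj (normal z))" .
qed

text \<open>The tangent is \<open>\<i> * z * q\<close> with \<open>q = normal z / z\<close> in the right half-plane, so its argument is
  \<open>\<theta> + pi / 2\<close> plus the principal argument of \<open>q\<close>.\<close>
lemma harm_tangent_arg:
  assumes r: "0 < r" "r < 1"
  shows "\<exists>\<phi>. tangent_arg (\<lambda>\<theta>. harm (of_real r * cis \<theta>)) \<phi> \<and>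
     (\<forall>\<theta>. \<exists>d. (\<phi> has_real_derivative d) (at \<theta>) \<and> d > \<alpha>)"
proof -
  define c where "c \<theta> = of_real r * cis \<theta>" for \<theta>
  define q where "q \<theta> = normal (c \<theta>) / c \<theta>" for \<theta>
  define \<phi> where "\<phi> \<theta> = \<theta> + pi / 2 + Im (Ln (q \<theta>))" for \<theta>
  have c: "c \<theta> \<noteq> 0" "norm (c \<theta>) < 1" for \<theta> using r by (auto simp: c_def norm_mult)
  have Re_q: "0 < Re (q \<theta>)" for \<theta>
    using normal_near_radius[OF c(2,1), of \<theta>] abs_Re_le_cmod[of "q \<theta> - 1"] by (simp add: q_def)
  have q_slit: "q \<theta> \<notin> \<real>\<^sub>\<le>\<^sub>0" for \<theta>
    using Re_q[of \<theta>] by (auto simp: complex_nonpos_Reals_iff)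
  have q0: "q \<theta> \<noteq> 0" for \<theta> using Re_q[of \<theta>] by auto
  have dq: "(q has_vector_derivative \<i> * (turn (c \<theta>) / c \<theta> - q \<theta>)) (at \<theta>)" for \<theta>
  proof -
    have q_eq: "q = (\<lambda>\<theta>. normal (c \<theta>) * (of_real (1 / r) * cis (- \<theta>)))"
      by (simp add: fun_eq_iff q_def c_def field_simps flip: cis_inverse)
    have inv: "of_real (1 / r) * cis (- \<theta>) = 1 / c \<theta>"
      by (simp add: c_def flip: cis_inverse) (simp add: field_simps)
    have "((\<lambda>\<theta>. of_real (1 / r) * cis (- \<theta>)) has_vector_derivative
        of_real (1 / r) * (\<i> * of_real (- 1) * cis (- \<theta>))) (at \<theta>)"
      by (intro has_vector_derivative_mult_right has_vector_derivative_cis DERIV_minus DERIV_ident)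
    from has_vector_derivative_mult[OF normal_on_circle this] r
    have "(q has_vector_derivative normal (c \<theta>) * (of_real (1 / r) * (\<i> * of_real (- 1) * cis (- \<theta>)))
        + \<i> * turn (c \<theta>) * (of_real (1 / r) * cis (- \<theta>))) (at \<theta>)"
      unfolding q_eq by (simp add: c_def)
    also have "normal (c \<theta>) * (of_real (1 / r) * (\<i> * of_real (- 1) * cis (- \<theta>)))
        = - \<i> * normal (c \<theta>) * (of_real (1 / r) * cis (- \<theta>))"
      by (simp add: algebra_simps)
    finally show ?thesis unfolding inv by (simp add: q_def[of \<theta>] algebra_simps)
  qed
  \<comment> \<open>\<open>d/d\<theta> (Ln q) = \<i> * (turn / normal - 1)\<close>, and the \<open>- 1\<close> cancels the derivative of \<open>\<theta>\<close>\<close>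
  have d\<phi>: "(\<phi> has_real_derivative Re (turn (c \<theta>) / normal (c \<theta>))) (at \<theta>)" for \<theta>
  proof -
    have "((\<lambda>\<theta>. Ln (q \<theta>)) has_vector_derivative \<i> * (turn (c \<theta>) / c \<theta> - q \<theta>) * inverse (q \<theta>)) (at \<theta>)"
      by (rule field_vector_diff_chain_at[OF dq has_field_derivative_Ln[OF q_slit], unfolded o_def])
    also have "\<i> * (turn (c \<theta>) / c \<theta> - q \<theta>) * inverse (q \<theta>) = \<i> * (turn (c \<theta>) / normal (c \<theta>) - 1)"
      using c(1)[of \<theta>] q0[of \<theta>] by (simp add: q_def field_simps)
    finally have "((\<lambda>\<theta>. Im (Ln (q \<theta>))) has_vector_derivative Im (\<i> * (turn (c \<theta>) / normal (c \<theta>) - 1))) (at \<theta>)"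
      by (rule bounded_linear.has_vector_derivative[OF bounded_linear_Im])
    then show ?thesis
      unfolding \<phi>_def[abs_def] has_real_derivative_iff_has_vector_derivative
      by (auto intro!: derivative_eq_intros)
  qed
  have "Re (turn (c \<theta>) / normal (c \<theta>)) > \<alpha>" for \<theta>
  proof -
    have "Re (turn (c \<theta>) / normal (c \<theta>))
        = Re (turn (c \<theta>) * cnj (normal (c \<theta>))) / (norm (normal (c \<theta>)))\<^sup>2"
      by (subst complex_div_cnj) (simp only: Re_divide_of_real flip: of_real_power)
    then show ?thesis using turn_gt[OF c(2,1), of \<theta>] by (simp add: pos_less_divide_eq)
  qed
  moreover have "tangent_arg (\<lambda>\<theta>. harm (c \<theta>)) \<phi>"
    unfolding tangent_arg_def
  proof (intro conjI allI)
    show "continuous_on UNIV \<phi>"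
      using d\<phi> by (meson DERIV_isCont continuous_at_imp_continuous_on)
    fix \<theta>
    have q_polar: "of_real (norm (q \<theta>)) * cis (Im (Ln (q \<theta>))) = q \<theta>"
      using exp_Ln[OF q0[of \<theta>]] q0[of \<theta>] by (simp add: exp_eq_polar)
    have cis_\<phi>: "cis (\<phi> \<theta>) = \<i> * cis \<theta> * cis (Im (Ln (q \<theta>)))"
      by (simp add: \<phi>_def cis_mult[symmetric] mult.commute)
    have nq: "normal (c \<theta>) = of_real r * (cis \<theta> * q \<theta>)"
      using c(1)[of \<theta>] by (simp add: q_def c_def)
    have "norm (\<i> * normal (c \<theta>)) = r * norm (q \<theta>)"
      using r by (simp add: nq norm_mult)
    then have "of_real (norm (\<i> * normal (c \<theta>))) * cis (\<phi> \<theta>)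
        = \<i> * (of_real r * (cis \<theta> * (of_real (norm (q \<theta>)) * cis (Im (Ln (q \<theta>))))))"
      unfolding cis_\<phi> by simp
    then have "\<i> * normal (c \<theta>) = of_real (norm (\<i> * normal (c \<theta>))) * cis (\<phi> \<theta>)"
      unfolding q_polar nq by (rule sym)
    then show "\<exists>v. ((\<lambda>\<theta>. harm (c \<theta>)) has_vector_derivative v) (at \<theta>) \<and> v \<noteq> 0 \<and>
        v = of_real (norm v) * cis (\<phi> \<theta>)"
      using harm_on_circle[of r \<theta>] r turn_gt(1)[OF c(2,1)] by (auto simp: c_def)
  qed
  ultimately show ?thesis using d\<phi> unfolding c_def by blast
qed

lemma harm_inj: "inj_on harm (ball 0 1)"
proof (rule inj_onI, rule ccontr)
  fix z w assume h: "z \<in> ball 0 1" "w \<in> ball 0 1" "harm z = harm w" "z \<noteq> w"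
  have *: False if "norm z \<le> norm w" "norm w < 1" "harm z = harm w" "z \<noteq> w" for z w
    using supporting_halfplane[of w z] that by (cases "w = 0") auto
  show False using h *[of z w] *[of w z] by (cases "norm z \<le> norm w") auto
qed

lemma harm_class_SH: "harm \<in> class_SH"
proof -
  define h where "h z = z + psum A z" for z
  define g where "g z = psum B z" for z
  have dh: "(h has_field_derivative 1 + psum (diffs A) z) (at z)"
    and dg: "(g has_field_derivative psum (diffs B) z) (at z)" if "norm z < 1" for z
    unfolding h_def[abs_def] g_def[abs_def] using that
    by (auto intro!: derivative_eq_intros psum_euler convA convB)
  have d: "deriv h z = 1 + psum (diffs A) z" "deriv g z = psum (diffs B) z" if "norm z < 1" for z
    using dh[OF that] dg[OF that] by (auto intro: DERIV_imp_deriv)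
  have at0: "psum (diffs A) 0 = 0" "psum (diffs B) 0 = 0" "psum A 0 = 0" "psum B 0 = 0"
    unfolding psum_def diffs_def using tA tB by (simp_all add: powser_zero)
  have dominates: "norm (deriv g z) < norm (deriv h z)" if z: "norm z < 1" for z
  proof (cases "z = 0")
    case True then show ?thesis using d[of 0] at0 by simp
  next
    case False
    have "0 \<le> (norm z)\<^sup>2 * (moment A 2 - moment A 1 + (moment B 2 - moment B 1))"
      using mA(3) mB(3) by simp
    then have "norm (psum (euler B) z) < norm (z + psum (euler A) z)"
      using analytic_dominates[OF False z] by linarith
    also have "z + psum (euler A) z = z * deriv h z"
      using d z by (simp add: psum_euler(3)[OF convA] algebra_simps)
    also have "psum (euler B) z = z * deriv g z"
      using d z by (simp add: psum_euler(3)[OF convB])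
    finally show ?thesis using False by (simp add: norm_mult)
  qed
  have "h field_differentiable at z" "g field_differentiable at z" if "z \<in> unit_disc" for z
    using dh[of z] dg[of z] that unfolding field_differentiable_def mem_ball_0 by blast+
  then have "h holomorphic_on unit_disc" "g holomorphic_on unit_disc"
    by (simp_all add: holomorphic_on_def field_differentiable_at_within)
  then have "harmonic_decomp harm h g"
    by (simp add: harmonic_decomp_def harm_def h_def g_def)
  have "h 0 = 0" "g 0 = 0" "deriv h 0 = 1" using at0 d[of 0] by (auto simp: h_def g_def)
  then show ?thesis
    unfolding class_SH_def using harm_inj dominates \<open>harmonic_decomp harm h g\<close> by (intro CollectI exI[of _ h] exI[of _ g]) auto
qed

lemma harm_convex_curve:
  assumes "0 < r" "r < 1"
  shows "convex_curve (harm ` sphere 0 r)"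
proof (rule convex_curve_if_supported[where D = normal])
  have "continuous_on (cball 0 r) (psum c)" if "conv_disc c" for c :: "nat \<Rightarrow> complex"
  proof (intro continuous_at_imp_continuous_on ballI)
    fix z :: complex assume "z \<in> cball 0 r"
    then show "isCont (psum c) z"
      using assms by (intro DERIV_isCont[OF psum_euler(1)[OF that]]) auto
  qed
  from this[OF convA] this[OF convB] show "continuous_on (cball 0 r) harm"
    unfolding harm_def by (intro continuous_intros)
  show "inj_on harm (cball 0 r)" by (rule inj_on_subset[OF harm_inj]) (use assms in auto)
  show "Re ((harm w - harm z) * cnj (normal w)) > 0" if "norm w = r" "norm z < r" for w z
    using that assms by (intro supporting_halfplane) auto
qed (use assms in auto)

theorem fully_convex_harm: "fully_convex_of_order \<alpha> harm"
  unfolding fully_convex_of_order_def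
proof (intro conjI allI impI harm_class_SH)
  fix r :: real assume r: "0 < r \<and> r < 1"
  show "inj_on harm (sphere 0 r)" by (rule inj_on_subset[OF harm_inj]) (use r in auto)
  show "convex_curve (harm ` sphere 0 r)" using r harm_convex_curve by blast
  show "\<exists>\<phi>. tangent_arg (\<lambda>\<theta>. harm (of_real r * cis \<theta>)) \<phi> \<and>
     (\<forall>\<theta>. 0 \<le> \<theta> \<and> \<theta> < 2 * pi \<longrightarrow> (\<exists>d. (\<phi> has_real_derivative d) (at \<theta>) \<and> d > \<alpha>))"
    using r harm_tangent_arg by blast
qed

end

section \<open>The radius polynomial\<close>

text \<open>In the variable \<open>u = 1 / (1 - x)\<close> the operator \<open>x * d/dx\<close> becomes \<open>(u ^ 2 - u) * d/du\<close>, so the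
  generating function of \<open>n ^ k\<close> is a polynomial in \<open>u\<close>.\<close>
fun power_sum_poly :: "nat \<Rightarrow> real poly" where
  "power_sum_poly 0 = [:0, 1:]"
| "power_sum_poly (Suc k) = pderiv (power_sum_poly k) * [:0, -1, 1:]"

lemma power_sum_sums:
  fixes x :: real
  assumes "\<bar>x\<bar> < 1"
  shows "(\<lambda>n. real n ^ k * x ^ n) sums poly (power_sum_poly k) (1 / (1 - x))"
  using assms
proof (induction k arbitrary: x)
  case 0
  then show ?case using geometric_sums[of x] by simp
next
  case (Suc k)
  let ?c = "\<lambda>n. real n ^ k" and ?u = "\<lambda>x::real. 1 / (1 - x)" and ?p = "power_sum_poly k"
  have conv: "conv_disc ?c"
    unfolding conv_disc_def using sums_summable[OF Suc.IH] by auto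
  have nz: "1 - x \<noteq> 0" using Suc.prems by auto
  have eq: "psum ?c y = poly ?p (?u y)" if "y \<in> ball 0 1" for y
    using sums_unique[OF Suc.IH[of y]] that by (simp add: psum_def)
  have "((\<lambda>y. poly ?p (?u y)) has_field_derivative psum (diffs ?c) x) (at x)"
    by (rule has_field_derivative_transform_within_open[OF psum_euler(1)[OF conv] open_ball[of 0 1] _ eq])
      (use Suc.prems in auto)
  moreover have "((\<lambda>y. poly ?p (?u y)) has_field_derivative poly (pderiv ?p) (?u x) * (?u x)\<^sup>2) (at x)"
    using nz by (auto intro!: derivative_eq_intros simp: power2_eq_square)
  ultimately have d: "psum (diffs ?c) x = poly (pderiv ?p) (?u x) * (?u x)\<^sup>2"
    by (rule DERIV_unique)
  have "x * (?u x)\<^sup>2 = (?u x)\<^sup>2 - ?u x"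
  proof -
    have "(1 - x) * ?u x = 1" using nz by simp
    then show ?thesis by algebra
  qed
  moreover have "poly (power_sum_poly (Suc k)) v = poly (pderiv ?p) v * (v\<^sup>2 - v)" for v
    by (simp add: algebra_simps power2_eq_square)
  moreover have "x * psum (diffs ?c) x = poly (pderiv ?p) (?u x) * (x * (?u x)\<^sup>2)"
    unfolding d by (rule mult.left_commute)
  ultimately have "x * psum (diffs ?c) x = poly (power_sum_poly (Suc k)) (?u x)"
    by (simp only:)
  with psum_euler(2)[OF conv, of x] Suc.prems show ?case
    by (simp add: euler_def mult.assoc)
qed

lemma cube_sums:
  fixes t :: real
  assumes "\<bar>t\<bar> < 1"
  shows "(\<lambda>n. real n ^ 3 * t ^ n) sums (t * (1 + 4 * t + t\<^sup>2) / (1 - t) ^ 4)"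
proof -
  define d where "d = 1 - t"
  have d: "d \<noteq> 0" "t = 1 - d" using assms by (auto simp: d_def)
  have "poly (power_sum_poly 3) (1 / d) = t * (1 + 4 * t + t\<^sup>2) / d ^ 4"
    unfolding d(2) using d(1)
    by (simp add: numeral_eq_Suc pderiv_pCons) (simp add: field_simps)
  then show ?thesis using power_sum_sums[OF assms, of 3] by (simp add: d_def)
qed

definition radius_poly :: "real \<Rightarrow> real \<Rightarrow> real" where
  "radius_poly \<alpha> r = 1 - \<alpha> - 2 * (15 - 7 * \<alpha>) * r - 12 * (1 + 3 * \<alpha>) * r ^ 2
     - 2 * (29 - 21 * \<alpha>) * r ^ 3 + 29 * (1 - \<alpha>) * r ^ 4 - 12 * (1 - \<alpha>) * r ^ 5
     + 2 * (1 - \<alpha>) * r ^ 6"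

text \<open>This is \<open>n ^ 2 * ((n - \<alpha>) * u + (n + \<alpha>) * v)\<close> for the extremal values
  \<open>u = (2 * n + 1) * (n + 1) / 6\<close> and \<open>v = (2 * n - 1) * (n - 1) / 6\<close>, where
  \<open>u + v = (2 * n ^ 2 + 1) / 3\<close> and \<open>u - v = n\<close>. At \<open>n = 1\<close> it equals \<open>1 - \<alpha>\<close>, the contribution of the
  normalised first coefficient.\<close>
definition extremal_weight :: "real \<Rightarrow> nat \<Rightarrow> real" where
  "extremal_weight \<alpha> n = real n ^ 3 * (2 * real n ^ 2 + 1 - 3 * \<alpha>) / 3"

text \<open>At a root of \<open>radius_poly\<close> the sum over \<open>n \<ge> 1\<close>, divided by \<open>t\<close>, is \<open>2 * (1 - \<alpha>)\<close>; without the
  term \<open>n = 1\<close> it is \<open>1 - \<alpha>\<close>, that is, equality in the coefficient condition.\<close>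
lemma extremal_weight_sums:
  fixes t :: real
  assumes "\<bar>t\<bar> < 1"
  shows "(\<lambda>n. extremal_weight \<alpha> n * t ^ n) sums (t * (2 * (1 - \<alpha>) - radius_poly \<alpha> t / (1 - t) ^ 6))"
proof -
  define d where "d = 1 - t"
  have d: "d \<noteq> 0" "t = 1 - d" using assms by (auto simp: d_def)
  have 5: "poly (power_sum_poly 5) (1 / d) = t * (1 + 26 * t + 66 * t\<^sup>2 + 26 * t ^ 3 + t ^ 4) / d ^ 6"
    unfolding d(2) using d(1)
    by (simp add: numeral_eq_Suc pderiv_pCons) (simp add: field_simps)
  have "(\<lambda>n. (2 * (real n ^ 5 * t ^ n) + (1 - 3 * \<alpha>) * (real n ^ 3 * t ^ n)) / 3) sums
      ((2 * (t * (1 + 26 * t + 66 * t\<^sup>2 + 26 * t ^ 3 + t ^ 4) / d ^ 6)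
        + (1 - 3 * \<alpha>) * (t * (1 + 4 * t + t\<^sup>2) / d ^ 4)) / 3)"
    using power_sum_sums[OF assms, of 5] 5 unfolding d_def[symmetric]
    by (intro sums_divide sums_add sums_mult cube_sums[OF assms, folded d_def]) simp
  also have "(\<lambda>n. (2 * (real n ^ 5 * t ^ n) + (1 - 3 * \<alpha>) * (real n ^ 3 * t ^ n)) / 3)
      = (\<lambda>n. extremal_weight \<alpha> n * t ^ n)"
    by (simp add: fun_eq_iff extremal_weight_def field_simps numeral_eq_Suc)
  also have "(2 * (t * (1 + 26 * t + 66 * t\<^sup>2 + 26 * t ^ 3 + t ^ 4) / d ^ 6)
        + (1 - 3 * \<alpha>) * (t * (1 + 4 * t + t\<^sup>2) / d ^ 4)) / 3
      = t * (2 * (1 - \<alpha>) - radius_poly \<alpha> t / d ^ 6)"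
  proof -
    let ?Q = "t * (1 + 26 * t + 66 * t\<^sup>2 + 26 * t ^ 3 + t ^ 4)"
    let ?K = "(1 - 3 * \<alpha>) * (t * (1 + 4 * t + t\<^sup>2) * d ^ 2)"
    have K: "(1 - 3 * \<alpha>) * (t * (1 + 4 * t + t\<^sup>2) / d ^ 4) = ?K / d ^ 6"
      using d(1) by (simp add: divide_simps flip: power_add)
    have id: "2 * ?Q + ?K = 3 * (t * (2 * (1 - \<alpha>) * d ^ 6 - radius_poly \<alpha> t))"
      unfolding d_def radius_poly_def by (simp add: algebra_simps numeral_eq_Suc)
    have "(2 * (?Q / d ^ 6) + ?K / d ^ 6) / 3 = (2 * ?Q + ?K) / d ^ 6 / 3"
      by (simp only: add_divide_distrib times_divide_eq_right)
    also have "\<dots> = t * (2 * (1 - \<alpha>) * d ^ 6 - radius_poly \<alpha> t) / d ^ 6"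
      unfolding id by simp
    also have "\<dots> = t * (2 * (1 - \<alpha>) - radius_poly \<alpha> t / d ^ 6)"
      using d(1) by (simp add: field_simps)
    finally show ?thesis unfolding K .
  qed
  finally show ?thesis unfolding d_def .
qed

text \<open>The only positive terms of the derivative are those in \<open>r ^ 3\<close> and \<open>r ^ 5\<close>; on the unit interval they are
  dominated by the terms in \<open>r ^ 2\<close> and \<open>r ^ 4\<close>.\<close>
lemma radius_poly_strict_decreasing:
  assumes \<alpha>: "0 \<le> \<alpha>" "\<alpha> < 1" and xy: "0 \<le> x" "x < y" "y \<le> 1"
  shows "radius_poly \<alpha> y < radius_poly \<alpha> x"
proof (rule DERIV_neg_imp_decreasing_open[OF xy(2)])
  fix r assume r: "x < r" "r < y"
  then have r01: "0 < r" "r < 1" using xy by auto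
  let ?D = "- 2 * (15 - 7 * \<alpha>) - 24 * (1 + 3 * \<alpha>) * r - 6 * (29 - 21 * \<alpha>) * r ^ 2
     + 116 * (1 - \<alpha>) * r ^ 3 - 60 * (1 - \<alpha>) * r ^ 4 + 12 * (1 - \<alpha>) * r ^ 5"
  have "(radius_poly \<alpha> has_real_derivative ?D) (at r)"
    unfolding radius_poly_def[abs_def]
    by (auto intro!: derivative_eq_intros simp: algebra_simps)
  moreover have "?D < 0"
  proof -
    have "(1 - \<alpha>) * r ^ 3 \<le> (1 - \<alpha>) * r ^ 2" "(1 - \<alpha>) * r ^ 5 \<le> (1 - \<alpha>) * r ^ 4"
      using r01 \<alpha> by (auto intro!: mult_left_mono power_decreasing)
    moreover have "0 \<le> (1 - \<alpha>) * r ^ 4" "0 \<le> (1 + 3 * \<alpha>) * r" "0 \<le> (58 - 10 * \<alpha>) * r ^ 2"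
      using r01 \<alpha> by auto
    ultimately show ?thesis using \<alpha> by (simp add: algebra_simps)
  qed
  ultimately show "\<exists>D. (radius_poly \<alpha> has_real_derivative D) (at r) \<and> D < 0" by blast
next
  show "continuous_on {x..y} (radius_poly \<alpha>)"
    unfolding radius_poly_def[abs_def] by (intro continuous_intros)
qed

lemma radius_poly_root:
  assumes "0 \<le> \<alpha>" "\<alpha> < 1"
  shows "\<exists>rc. 0 < rc \<and> rc < 1 \<and> (\<forall>r. 0 < r \<and> r < 1 \<longrightarrow> (radius_poly \<alpha> r = 0 \<longleftrightarrow> r = rc))"
proof -
  have ends: "radius_poly \<alpha> 0 > 0" "radius_poly \<alpha> 1 < 0"
    using assms by (simp_all add: radius_poly_def)
  have "continuous_on {0..1} (radius_poly \<alpha>)"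
    unfolding radius_poly_def[abs_def] by (intro continuous_intros)
  then obtain rc where rc: "0 \<le> rc" "rc \<le> 1" "radius_poly \<alpha> rc = 0"
    using IVT2'[of "radius_poly \<alpha>" 1 0 0] ends by auto
  moreover have "rc \<noteq> 0" "rc \<noteq> 1" using rc ends by auto
  moreover have "r = rc" if "0 < r" "r < 1" "radius_poly \<alpha> r = 0" for r
    using radius_poly_strict_decreasing[OF assms, of r rc]
      radius_poly_strict_decreasing[OF assms, of rc r] that rc by force
  ultimately show ?thesis by (metis order_less_le)
qed

section \<open>Full convexity up to the root\<close>

text \<open>Coefficients of \<open>z * f' z\<close> after replacing \<open>z\<close> by \<open>R * z\<close> and dividing by \<open>R\<close>, without the linear
  term, which remains \<open>z\<close>.\<close>
definition dilated :: "(nat \<Rightarrow> complex) \<Rightarrow> real \<Rightarrow> nat \<Rightarrow> complex" where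
  "dilated c R n = (if n < 2 then 0 else of_nat n * c n * of_real (R ^ n / R))"

lemma conv_disc_polynomial_growth:
  fixes c :: "nat \<Rightarrow> complex"
  assumes "\<And>n. norm (c n) \<le> real n ^ k"
  shows "conv_disc c"
  unfolding conv_disc_def
proof (intro allI impI)
  fix z :: complex assume z: "norm z < 1"
  show "summable (\<lambda>n. c n * z ^ n)"
  proof (rule summable_comparison_test)
    show "summable (\<lambda>n. real n ^ k * norm z ^ n)"
      using sums_summable[OF power_sum_sums[of "norm z"]] z by simp
    show "\<exists>N. \<forall>n\<ge>N. norm (c n * z ^ n) \<le> real n ^ k * norm z ^ n"
      using assms by (simp add: norm_mult norm_power mult_right_mono)
  qed
qed

lemma rescaled_D_op_series:
  assumes dec: "harmonic_decomp f h g"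
    and h: "\<forall>z\<in>unit_disc. (\<lambda>n. a (n + 2) * z ^ (n + 2)) sums (h z - z)"
    and g: "\<forall>z\<in>unit_disc. (\<lambda>n. b (n + 2) * z ^ (n + 2)) sums g z"
    and R: "0 < R" "R \<le> 1"
  shows "conv_disc (dilated a R)" and "conv_disc (\<lambda>n. - cnj \<epsilon> * dilated b R n)"
    and "norm z < 1 \<Longrightarrow> rescale R (D_op \<epsilon> f) z
     = z + psum (dilated a R) z + cnj (psum (\<lambda>n. - cnj \<epsilon> * dilated b R n) z)"
proof -
  note a = bspec[OF h] and b = bspec[OF g]
  define cut :: "(nat \<Rightarrow> complex) \<Rightarrow> nat \<Rightarrow> complex" where "cut c n = (if n < 2 then 0 else c n)" for c n
  have cut: "(\<lambda>n. cut c n * z ^ n) sums s" if "(\<lambda>n. c (n + 2) * z ^ (n + 2)) sums s" for c z s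
  proof -
    have "(\<lambda>n. cut c (n + 2) * z ^ (n + 2)) sums s" using that by (simp add: cut_def)
    then have "(\<lambda>n. cut c n * z ^ n) sums (s + (\<Sum>i<2. cut c i * z ^ i))"
      by (rule iffD1[OF sums_iff_shift[where f = "\<lambda>n. cut c n * z ^ n" and n = 2]])
    then show ?thesis by (simp add: cut_def lessThan_Suc numeral_2_eq_2)
  qed
  have ca: "conv_disc (cut a)" and cb: "conv_disc (cut b)"
    unfolding conv_disc_def using sums_summable[OF cut[OF a]] sums_summable[OF cut[OF b]] by auto
  have Rz: "norm (of_real R * z) < 1" if "norm z < 1" for z :: complex
    using R that mult_left_le_one_le[of "norm z" R] by (simp add: norm_mult)
  have h': "w * deriv h w = w + psum (euler (cut a)) w" if "norm w < 1" for w
  proof -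
    have der: "((\<lambda>z. z + psum (cut a) z) has_field_derivative 1 + psum (diffs (cut a)) w) (at w)"
      by (intro derivative_intros psum_euler(1) ca that)
    have "z + psum (cut a) z = h z" if "z \<in> unit_disc" for z
      using sums_unique[OF cut[OF a[OF that]]] by (simp add: psum_def algebra_simps)
    then have "(h has_field_derivative 1 + psum (diffs (cut a)) w) (at w)"
      by (rule has_field_derivative_transform_within_open[OF der open_ball[of 0 1], rotated])
        (use that in auto)
    then show ?thesis
      using psum_euler(3)[OF ca that] by (simp add: DERIV_imp_deriv algebra_simps)
  qed
  have g': "w * deriv g w = psum (euler (cut b)) w" if "norm w < 1" for w
  proof -
    have "psum (cut b) z = g z" if "z \<in> unit_disc" for z
      using sums_unique[OF cut[OF b[OF that]]] by (simp add: psum_def)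
    then have "(g has_field_derivative psum (diffs (cut b)) w) (at w)"
      by (rule has_field_derivative_transform_within_open[OF psum_euler(1)[OF cb that] open_ball[of 0 1], rotated])
        (use that in auto)
    then show ?thesis using psum_euler(3)[OF cb that] by (simp add: DERIV_imp_deriv)
  qed
  have dil: "(\<lambda>n. dilated c R n * z ^ n) sums (psum (euler (cut c)) (of_real R * z) / of_real R)"
    if "conv_disc (cut c)" "norm z < 1" for c z
  proof -
    have "(\<lambda>n. euler (cut c) n * (of_real R * z) ^ n / of_real R) sums (psum (euler (cut c)) (of_real R * z) / of_real R)"
      by (intro sums_divide psum_sums conv_disc_euler that Rz)
    also have "(\<lambda>n. euler (cut c) n * (of_real R * z) ^ n / of_real R) = (\<lambda>n. dilated c R n * z ^ n)"
      by (simp add: fun_eq_iff euler_def cut_def dilated_def power_mult_distrib)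
    finally show ?thesis .
  qed
  show "conv_disc (dilated a R)"
    unfolding conv_disc_def using sums_summable[OF dil[OF ca]] by auto
  have dilb: "(\<lambda>n. - cnj \<epsilon> * dilated b R n * z ^ n) sums (- cnj \<epsilon> * (psum (euler (cut b)) (of_real R * z) / of_real R))"
    if "norm z < 1" for z
    using sums_mult[OF dil[OF cb that], of "- cnj \<epsilon>"] by (simp add: mult.assoc)
  show "conv_disc (\<lambda>n. - cnj \<epsilon> * dilated b R n)"
    unfolding conv_disc_def using sums_summable[OF dilb] by auto
  assume z: "norm z < 1"
  have "rescale R (D_op \<epsilon> f) z =
      (of_real R * z + psum (euler (cut a)) (of_real R * z)
       - \<epsilon> * cnj (psum (euler (cut b)) (of_real R * z))) / of_real R"
    unfolding rescale_def using Rz[OF z]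
    by (subst D_op_harmonic_decomp[OF dec]) (auto simp: h' g' simp del: complex_cnj_mult)
  also have "\<dots> = z + psum (euler (cut a)) (of_real R * z) / of_real R
       + cnj (- cnj \<epsilon> * (psum (euler (cut b)) (of_real R * z) / of_real R))"
    using R by (simp add: field_simps)
  finally show "rescale R (D_op \<epsilon> f) z
     = z + psum (dilated a R) z + cnj (psum (\<lambda>n. - cnj \<epsilon> * dilated b R n) z)"
    unfolding sums_unique[OF dil[OF ca z], folded psum_def] sums_unique[OF dilb[OF z], folded psum_def] .
qed

lemma fully_convex_of_order_cong:
  assumes eq: "\<And>z. norm z < 1 \<Longrightarrow> F z = G z"
  shows "fully_convex_of_order \<alpha> F \<longleftrightarrow> fully_convex_of_order \<alpha> G"
proof -
  have "harmonic_decomp F h g \<longleftrightarrow> harmonic_decomp G h g" for h g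
    unfolding harmonic_decomp_def using eq by auto
  moreover have "inj_on F unit_disc \<longleftrightarrow> inj_on G unit_disc"
    by (rule inj_on_cong) (use eq in auto)
  ultimately have "F \<in> class_SH \<longleftrightarrow> G \<in> class_SH" unfolding class_SH_def by auto
  moreover have "inj_on F (sphere 0 r) \<longleftrightarrow> inj_on G (sphere 0 r)" "F ` sphere 0 r = G ` sphere 0 r"
    "(\<lambda>\<theta>. F (of_real r * cis \<theta>)) = (\<lambda>\<theta>. G (of_real r * cis \<theta>))" if "0 < r \<and> r < 1" for r
    using that eq by (auto intro!: inj_on_cong image_cong simp: fun_eq_iff norm_mult)
  ultimately show ?thesis
    unfolding fully_convex_of_order_def by (simp cong: conj_cong imp_cong)
qed

text \<open>Both coefficient bounds enter the weight with nonnegative factors \<open>n - \<alpha>\<close> and \<open>n + \<alpha>\<close>, so term by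
  term the weight is at most \<open>extremal_weight\<close>, whose sum is known at the root.\<close>
lemma fully_convex_up_to_root:
  assumes \<alpha>: "0 \<le> \<alpha>" "\<alpha> < 1" and r: "0 < r" "r < 1" "radius_poly \<alpha> r = 0"
    and \<epsilon>: "norm \<epsilon> = 1" and f: "coeff_bounded_harmonic f"
  shows "fully_convex_of_order \<alpha> (rescale r (D_op \<epsilon> f))"
proof -
  obtain h g a b where dec: "harmonic_decomp f h g"
    and series: "\<forall>z\<in>unit_disc. (\<lambda>n. a (n + 2) * z ^ (n + 2)) sums (h z - z)"
      "\<forall>z\<in>unit_disc. (\<lambda>n. b (n + 2) * z ^ (n + 2)) sums g z"
    and bounds: "\<forall>n\<ge>2. norm (a n) \<le> (2 * real n + 1) * (real n + 1) / 6 \<and>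
             norm (b n) \<le> (2 * real n - 1) * (real n - 1) / 6 \<and>
             \<bar>norm (a n) - norm (b n)\<bar> \<le> real n"
    using f unfolding coeff_bounded_harmonic_def by (elim exE conjE)
  have bd: "norm (a n) \<le> (2 * real n + 1) * (real n + 1) / 6"
    "norm (b n) \<le> (2 * real n - 1) * (real n - 1) / 6" if "n \<ge> 2" for n
    using bounds that by auto
  define A where "A = dilated a r"
  define B where "B = (\<lambda>n. - cnj \<epsilon> * dilated b r n)"
  have nA: "norm (A n) = (if n < 2 then 0 else real n * norm (a n) * (r ^ n / r))" for n
    using r by (simp add: A_def dilated_def norm_mult norm_divide norm_power)
  have nB: "norm (B n) = (if n < 2 then 0 else real n * norm (b n) * (r ^ n / r))" for n
    using r \<epsilon> by (simp add: B_def dilated_def norm_mult norm_divide norm_power)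
  \<comment> \<open>the coefficient bounds are at most \<open>n ^ 2\<close>, so \<open>n ^ 2 * norm (A n)\<close> grows at most like \<open>n ^ 5 * r ^ n\<close>\<close>
  have s5: "summable (\<lambda>n. real n ^ 5 * r ^ n / r)"
    using sums_summable[OF power_sum_sums[of r 5]] r by (intro summable_divide) auto
  have dom: "norm (c n) \<le> real n ^ 2 \<Longrightarrow> real n ^ 2 * (real n * norm (c n) * (r ^ n / r)) \<le> real n ^ 5 * r ^ n / r"
    for c :: "nat \<Rightarrow> complex" and n
  proof -
    assume "norm (c n) \<le> real n ^ 2"
    then have "real n ^ 3 * (r ^ n / r) * norm (c n) \<le> real n ^ 3 * (r ^ n / r) * real n ^ 2"
      using r by (intro mult_left_mono) auto
    then show ?thesis by (simp add: numeral_eq_Suc mult_ac)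
  qed
  have sA: "summable (\<lambda>n. real n ^ 2 * norm (A n))"
  proof (rule summable_comparison_test[OF _ s5], intro exI allI impI)
    fix n :: nat
    show "norm (real n ^ 2 * norm (A n)) \<le> real n ^ 5 * r ^ n / r"
    proof (cases "n < 2")
      case False
      have "(2 * real n + 1) * (real n + 1) / 6 \<le> real n ^ 2"
      proof -
        have "0 \<le> (real n - 1) * (4 * real n + 1)" using False by (intro mult_nonneg_nonneg) auto
        then show ?thesis by (simp add: algebra_simps power2_eq_square)
      qed
      with False show ?thesis using dom[of a n] bd(1)[of n] r by (simp add: nA)
    qed (use r in \<open>simp add: nA\<close>)
  qed
  have sB: "summable (\<lambda>n. real n ^ 2 * norm (B n))"
  proof (rule summable_comparison_test[OF _ s5], intro exI allI impI)
    fix n :: nat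
    show "norm (real n ^ 2 * norm (B n)) \<le> real n ^ 5 * r ^ n / r"
    proof (cases "n < 2")
      case False
      have "(2 * real n - 1) * (real n - 1) / 6 \<le> real n ^ 2"
      proof -
        have "0 \<le> 4 * real n * real n + (3 * real n - 1)" using False by (intro add_nonneg_nonneg) auto
        then show ?thesis by (simp add: algebra_simps power2_eq_square)
      qed
      with False show ?thesis using dom[of b n] bd(2)[of n] r by (simp add: nB)
    qed (use r in \<open>simp add: nB\<close>)
  qed
  have zero: "A n = 0" "B n = 0" if "n < 2" for n using that by (simp_all add: A_def B_def dilated_def)
  have weight: "moment A 2 - \<alpha> * moment A 1 + moment B 2 + \<alpha> * moment B 1 \<le> 1 - \<alpha>"
  proof -
    have mA: "(\<lambda>n. real n ^ k * norm (A n)) sums moment A k" if "k \<le> 2" for k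
      by (rule moment_sums_tail(1)[OF zero(1) sA that])
    have mB: "(\<lambda>n. real n ^ k * norm (B n)) sums moment B k" if "k \<le> 2" for k
      by (rule moment_sums_tail(1)[OF zero(2) sB that])
    have l: "(\<lambda>n. real n ^ 2 * norm (A n) - \<alpha> * (real n ^ 1 * norm (A n)) + real n ^ 2 * norm (B n)
          + \<alpha> * (real n ^ 1 * norm (B n)))
        sums (moment A 2 - \<alpha> * moment A 1 + moment B 2 + \<alpha> * moment B 1)"
      by (intro sums_add sums_diff sums_mult mA mB) auto
    \<comment> \<open>the term \<open>n = 1\<close> belongs to the linear coefficient, which the weight leaves out\<close>
    have "(\<lambda>n. extremal_weight \<alpha> n * r ^ n / r - (if n = 1 then 1 - \<alpha> else 0))
        sums (r * (2 * (1 - \<alpha>) - radius_poly \<alpha> r / (1 - r) ^ 6) / r - (1 - \<alpha>))"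
      using r by (intro sums_diff sums_divide extremal_weight_sums sums_single) auto
    moreover have "r * (2 * (1 - \<alpha>) - radius_poly \<alpha> r / (1 - r) ^ 6) / r - (1 - \<alpha>) = 1 - \<alpha>"
      using r by (simp add: field_simps)
    ultimately have u: "(\<lambda>n. extremal_weight \<alpha> n * r ^ n / r - (if n = 1 then 1 - \<alpha> else 0)) sums (1 - \<alpha>)"
      by (simp only:)
    show ?thesis
    proof (rule sums_le[OF _ l u])
      fix n :: nat
      show "real n ^ 2 * norm (A n) - \<alpha> * (real n ^ 1 * norm (A n)) + real n ^ 2 * norm (B n)
          + \<alpha> * (real n ^ 1 * norm (B n))
          \<le> extremal_weight \<alpha> n * r ^ n / r - (if n = 1 then 1 - \<alpha> else 0)"
      proof (cases "n < 2")
        case True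
        then have "n = 0 \<or> n = 1" by auto
        then show ?thesis using r by (auto simp: nA nB extremal_weight_def)
      next
        case False
        let ?x = "real n"
        have "?x\<^sup>2 * (?x - \<alpha>) * norm (a n) + ?x\<^sup>2 * (?x + \<alpha>) * norm (b n)
            \<le> ?x\<^sup>2 * (?x - \<alpha>) * ((2 * ?x + 1) * (?x + 1) / 6) + ?x\<^sup>2 * (?x + \<alpha>) * ((2 * ?x - 1) * (?x - 1) / 6)"
          using False \<alpha> bd[of n] by (intro add_mono mult_left_mono) auto
        also have "\<dots> = extremal_weight \<alpha> n"
          by (simp add: extremal_weight_def field_simps numeral_eq_Suc)
        finally have "(?x\<^sup>2 * (?x - \<alpha>) * norm (a n) + ?x\<^sup>2 * (?x + \<alpha>) * norm (b n)) * (r ^ n / r)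
            \<le> extremal_weight \<alpha> n * (r ^ n / r)"
          using r by (intro mult_right_mono) auto
        moreover have "?x ^ 2 * norm (A n) - \<alpha> * (?x ^ 1 * norm (A n)) + ?x ^ 2 * norm (B n)
            + \<alpha> * (?x ^ 1 * norm (B n))
            = (?x\<^sup>2 * (?x - \<alpha>) * norm (a n) + ?x\<^sup>2 * (?x + \<alpha>) * norm (b n)) * (r ^ n / r)"
          using False by (simp add: nA nB algebra_simps power2_eq_square add_divide_distrib diff_divide_distrib)
        ultimately show ?thesis using False by simp
      qed
    qed
  qed
  interpret convex_harmonic_series \<alpha> A B
    by unfold_locales (use \<alpha> zero sA sB weight in auto)
  have "rescale r (D_op \<epsilon> f) z = harm z" if "norm z < 1" for z
    unfolding harm_def unfolding A_def B_def
    by (rule rescaled_D_op_series(3)[OF dec series]) (use r that in auto)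
  then show ?thesis using fully_convex_of_order_cong fully_convex_harm by blast
qed

section \<open>Sharpness\<close>
lemma (in harmonic_series) real_coefficients:
  fixes p q :: "nat \<Rightarrow> real" and x :: real
  assumes A: "\<And>n. A n = of_real (p n)" and B: "\<And>n. B n = of_real (q n)" and x: "\<bar>x\<bar> < 1"
  shows "(\<lambda>n. real n * (p n - q n) * x ^ n) sums S \<Longrightarrow> normal (of_real x) = of_real (x + S)"
    and "(\<lambda>n. real n ^ 2 * (p n + q n) * x ^ n) sums S \<Longrightarrow> turn (of_real x) = of_real (x + S)"
proof -
  let ?z = "of_real x :: complex"
  have z: "norm ?z < 1" using x by simp
  assume "(\<lambda>n. real n * (p n - q n) * x ^ n) sums S"
  from sums_of_real[OF this]
  have "(\<lambda>n. euler A n * ?z ^ n - cnj (euler B n * ?z ^ n)) sums of_real S"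
    by (simp add: euler_def A B algebra_simps)
  moreover have "(\<lambda>n. euler A n * ?z ^ n - cnj (euler B n * ?z ^ n)) sums
      (psum (euler A) ?z - cnj (psum (euler B) ?z))"
    unfolding sums_cnj
    by (intro sums_diff sums_cnj[THEN iffD2] psum_sums conv_disc_euler convA convB z)
  ultimately have "psum (euler A) ?z - cnj (psum (euler B) ?z) = of_real S" by (rule sums_unique2[symmetric])
  then show "normal ?z = of_real (x + S)" by (simp add: normal_def diff_add_eq[symmetric])
next
  let ?z = "of_real x :: complex"
  have z: "norm ?z < 1" using x by simp
  assume "(\<lambda>n. real n ^ 2 * (p n + q n) * x ^ n) sums S"
  from sums_of_real[OF this]
  have "(\<lambda>n. euler (euler A) n * ?z ^ n + cnj (euler (euler B) n * ?z ^ n)) sums of_real S"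
    by (simp add: euler_def A B algebra_simps power2_eq_square)
  moreover have "(\<lambda>n. euler (euler A) n * ?z ^ n + cnj (euler (euler B) n * ?z ^ n)) sums
      (psum (euler (euler A)) ?z + cnj (psum (euler (euler B)) ?z))"
    by (intro sums_add sums_cnj[THEN iffD2] psum_sums conv_disc_euler convA convB z)
  ultimately have "psum (euler (euler A)) ?z + cnj (psum (euler (euler B)) ?z) = of_real S" by (rule sums_unique2[symmetric])
  then show "turn ?z = of_real (x + S)" by (simp add: turn_def add.assoc)
qed

text \<open>Where normal and turn are real, the tangent turns at the rate \<open>\<tau> / \<nu>\<close>. That \<open>\<nu> > 0\<close> comes from
  regularity of the image curves: \<open>\<nu>\<close> is positive at \<open>0\<close> and a zero of \<open>\<nu>\<close> would be a point with
  vanishing tangent.\<close>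
lemma (in harmonic_series) real_axis_criterion:
  fixes \<nu> \<tau> :: "real \<Rightarrow> real"
  assumes "0 \<le> \<alpha>" and conv: "fully_convex_of_order \<alpha> harm"
    and \<nu>: "\<And>x. 0 < x \<Longrightarrow> x < 1 \<Longrightarrow> normal (of_real x) = of_real (x * \<nu> x)"
    and \<tau>: "\<And>x. 0 < x \<Longrightarrow> x < 1 \<Longrightarrow> turn (of_real x) = of_real (x * \<tau> x)"
    and cont: "continuous_on {0..<1} \<nu>" and \<nu>0: "0 < \<nu> 0"
    and x: "0 < x" "x < 1"
  shows "\<alpha> * \<nu> x < \<tau> x"
proof -
  have rate: "\<exists>d>\<alpha>. \<tau> y * \<nu> y = d * (\<nu> y)\<^sup>2 \<and> \<nu> y \<noteq> 0" if y: "0 < y" "y < 1" for y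
  proof -
    obtain \<phi> where ta: "tangent_arg (\<lambda>\<theta>. harm (of_real y * cis \<theta>)) \<phi>"
      and der: "\<forall>\<theta>. 0 \<le> \<theta> \<and> \<theta> < 2 * pi \<longrightarrow> (\<exists>d. (\<phi> has_real_derivative d) (at \<theta>) \<and> d > \<alpha>)"
      using conv y unfolding fully_convex_of_order_def by blast
    from der obtain d where d: "(\<phi> has_real_derivative d) (at 0)" "d > \<alpha>"
      using pi_gt_zero by (metis mult_pos_pos order_refl zero_less_numeral)
    have "normal (of_real y) \<noteq> 0"
      "Re (turn (of_real y) * cnj (normal (of_real y))) = d * (norm (normal (of_real y)))\<^sup>2"
      using turning_rate[OF _ y(2) ta d(1)] y by simp_all
    then have "\<nu> y \<noteq> 0" "(y * \<tau> y) * (y * \<nu> y) = d * (y * \<nu> y)\<^sup>2"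
      unfolding \<nu>[OF y] \<tau>[OF y] norm_of_real by (auto simp flip: of_real_mult)
    then have "\<tau> y * \<nu> y = d * (\<nu> y)\<^sup>2" using y by (simp add: power2_eq_square)
    with d(2) \<open>\<nu> y \<noteq> 0\<close> show ?thesis by blast
  qed
  have "0 < \<nu> x"
  proof (rule ccontr)
    assume "\<not> 0 < \<nu> x"
    moreover have "continuous_on {0..x} \<nu>"
      by (rule continuous_on_subset[OF cont]) (use x in auto)
    ultimately obtain y where "0 \<le> y" "y \<le> x" "\<nu> y = 0"
      using IVT2'[of \<nu> x 0 0] \<nu>0 x by auto
    then show False using rate[of y] \<nu>0 x by (cases "y = 0") auto
  qed
  moreover obtain d where "d > \<alpha>" "\<tau> x * \<nu> x = d * (\<nu> x)\<^sup>2" using rate[OF x] by blast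
  ultimately show ?thesis by (simp add: power2_eq_square)
qed

text \<open>The factor \<open>\<epsilon>\<close> in \<open>b n\<close> cancels the one in the operator, so that the rescaled function has negative
  coefficients for every \<open>\<epsilon>\<close>. On the real axis their contributions to \<open>turn - \<alpha> * normal\<close> then add up to
  the extremal weight.\<close>
lemma not_fully_convex_beyond_root:
  assumes \<alpha>: "0 \<le> \<alpha>" "\<alpha> < 1" and rc: "0 < rc" "radius_poly \<alpha> rc = 0"
    and R: "rc < R" "R \<le> 1" and \<epsilon>: "norm \<epsilon> = 1"
  shows "\<exists>f. coeff_bounded_harmonic f \<and> \<not> fully_convex_of_order \<alpha> (rescale R (D_op \<epsilon> f))"
proof -
  define u :: "nat \<Rightarrow> real" where "u n = (2 * real n + 1) * (real n + 1) / 6" for n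
  define v :: "nat \<Rightarrow> real" where "v n = (2 * real n - 1) * (real n - 1) / 6" for n
  define a :: "nat \<Rightarrow> complex" where "a n = (if n < 2 then 0 else - of_real (u n))" for n
  define b :: "nat \<Rightarrow> complex" where "b n = (if n < 2 then 0 else \<epsilon> * of_real (v n))" for n
  define h where "h z = z + psum a z" for z
  define f where "f z = h z + cnj (psum b z)" for z
  have uv: "0 \<le> u n" "0 \<le> v n" "u n \<le> real n ^ 2" "v n \<le> real n ^ 2" "u n - v n = real n" if "n \<ge> 2" for n
  proof -
    have "0 \<le> v n" using that by (auto simp: v_def intro!: mult_nonneg_nonneg)
    moreover have "0 \<le> (real n - 1) * (4 * real n + 1)" "0 \<le> 4 * real n * real n + (3 * real n - 1)"
      using that by (auto intro!: mult_nonneg_nonneg add_nonneg_nonneg)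
    ultimately show "0 \<le> u n" "0 \<le> v n" "u n \<le> real n ^ 2" "v n \<le> real n ^ 2" "u n - v n = real n"
      using that by (auto simp: u_def v_def field_simps power2_eq_square)
  qed
  have ca: "conv_disc a" and cb: "conv_disc b"
    using uv \<epsilon> by (auto intro!: conv_disc_polynomial_growth[where k = 2] simp: a_def b_def norm_mult)
  have shift: "(\<lambda>n. c (n + 2) * z ^ (n + 2)) sums psum c z" if "conv_disc c" "\<And>n. n < 2 \<Longrightarrow> c n = 0" "norm z < 1"
    for c :: "nat \<Rightarrow> complex" and z
    using iffD2[OF sums_iff_shift[where f = "\<lambda>n. c n * z ^ n" and n = 2 and s = "psum c z"]]
      psum_sums[OF that(1,3)] that(2) by (simp add: lessThan_Suc numeral_2_eq_2)
  have holo: "psum c holomorphic_on unit_disc" if "conv_disc c" for c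
    using psum_euler(1)[OF that] unfolding holomorphic_on_open[OF open_ball] by (metis mem_ball_0)
  have dec: "harmonic_decomp f h (psum b)"
    unfolding harmonic_decomp_def f_def h_def
    by (intro conjI holomorphic_intros holo ca cb) simp
  have sa: "\<forall>z\<in>unit_disc. (\<lambda>n. a (n + 2) * z ^ (n + 2)) sums (h z - z)"
    using shift[OF ca] by (simp add: h_def a_def)
  have sb: "\<forall>z\<in>unit_disc. (\<lambda>n. b (n + 2) * z ^ (n + 2)) sums psum b z"
    using shift[OF cb] by (simp add: b_def)
  have ab: "norm (a n) = u n" "norm (b n) = v n" if "n \<ge> 2" for n
    using uv[OF that] that \<epsilon> by (auto simp: a_def b_def norm_mult)
  have bounds: "norm (a n) \<le> (2 * real n + 1) * (real n + 1) / 6 \<and>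
      norm (b n) \<le> (2 * real n - 1) * (real n - 1) / 6 \<and>
      \<bar>norm (a n) - norm (b n)\<bar> \<le> real n" if "n \<ge> 2" for n
    unfolding ab[OF that] uv(5)[OF that] by (simp add: u_def v_def)
  have "coeff_bounded_harmonic f"
    unfolding coeff_bounded_harmonic_def
    by (rule exI[of _ h], rule exI[of _ "psum b"], rule exI[of _ a], rule exI[of _ b])
      (use dec sa sb bounds in blast)
  moreover have "\<not> fully_convex_of_order \<alpha> (rescale R (D_op \<epsilon> f))"
  proof
    assume fc: "fully_convex_of_order \<alpha> (rescale R (D_op \<epsilon> f))"
    have R0: "0 < R" using rc R by simp
    define A where "A = dilated a R"
    define B where "B = (\<lambda>n. - cnj \<epsilon> * dilated b R n)"
    have "conv_disc A" "conv_disc B"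
      unfolding A_def B_def by (rule rescaled_D_op_series[OF dec sa sb R0 R(2)])+
    then
    interpret harmonic_series A B
      by unfold_locales (auto simp: A_def B_def dilated_def)
    have "rescale R (D_op \<epsilon> f) z = harm z" if "norm z < 1" for z
      unfolding harm_def unfolding A_def B_def
      by (rule rescaled_D_op_series(3)[OF dec sa sb R0 R(2) that])
    then have fc': "fully_convex_of_order \<alpha> harm" using fc fully_convex_of_order_cong by blast
    define p where "p n = (if n < 2 then 0 else - (real n * u n * (R ^ n / R)))" for n
    define q where "q n = (if n < 2 then 0 else - (real n * v n * (R ^ n / R)))" for n
    have pA: "A n = of_real (p n)" for n by (simp add: A_def dilated_def a_def p_def)
    have "cnj \<epsilon> * \<epsilon> = 1" using \<epsilon> complex_norm_square[of \<epsilon>] by (simp add: mult.commute)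
    then have qB: "B n = of_real (q n)" for n
      by (simp add: B_def dilated_def b_def q_def)
    define \<nu> where "\<nu> x = 2 - (1 + 4 * (R * x) + (R * x)\<^sup>2) / (1 - R * x) ^ 4" for x
    define \<tau> where "\<tau> x = radius_poly 0 (R * x) / (1 - R * x) ^ 6" for x
    have Rx: "0 < R * x" "R * x < 1" if "0 < x" "x < 1" for x
      using that R0 R(2) le_less_trans[OF mult_left_le_one_le[of x R], of 1] by simp_all
    have cancel: "x + (x - R * x * Q / D / R) = x * (2 - Q / D)" for x Q D
      using R0 by (simp add: right_diff_distrib)
    have n1: "normal (of_real x) = of_real (x * \<nu> x)" if x: "0 < x" "x < 1" for x
    proof -
      have "(\<lambda>n. (if n = 1 then x else 0) - real n ^ 3 * (R * x) ^ n / R) sums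
          (x - R * x * (1 + 4 * (R * x) + (R * x)\<^sup>2) / (1 - R * x) ^ 4 / R)"
        using Rx[OF x] by (intro sums_diff sums_divide cube_sums sums_single) auto
      also have "(\<lambda>n. (if n = 1 then x else 0) - real n ^ 3 * (R * x) ^ n / R)
          = (\<lambda>n. real n * (p n - q n) * x ^ n)"
      proof
        fix n :: nat
        show "(if n = 1 then x else 0) - real n ^ 3 * (R * x) ^ n / R = real n * (p n - q n) * x ^ n"
        proof (cases "n < 2")
          case True
          then have "n = 0 \<or> n = 1" by auto
          then show ?thesis using R0 by (auto simp: p_def q_def)
        next
          case False
          then have "p n - q n = - (real n * (u n - v n) * (R ^ n / R))"
            by (simp add: p_def q_def algebra_simps diff_divide_distrib)
          then show ?thesis
            using False uv(5)[of n] by (simp add: power_mult_distrib numeral_eq_Suc)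
        qed
      qed
      finally have "normal (of_real x) = of_real (x + (x - R * x * (1 + 4 * (R * x) + (R * x)\<^sup>2)
          / (1 - R * x) ^ 4 / R))"
        by (rule real_coefficients(1)[OF pA qB, rotated]) (use x in simp)
      then show ?thesis unfolding cancel \<nu>_def .
    qed
    have t1: "turn (of_real x) = of_real (x * \<tau> x)" if x: "0 < x" "x < 1" for x
    proof -
      have "(\<lambda>n. (if n = 1 then x else 0) - extremal_weight 0 n * (R * x) ^ n / R) sums
          (x - R * x * (2 * (1 - 0) - radius_poly 0 (R * x) / (1 - R * x) ^ 6) / R)"
        using Rx[OF x] by (intro sums_diff sums_divide extremal_weight_sums sums_single) auto
      also have "(\<lambda>n. (if n = 1 then x else 0) - extremal_weight 0 n * (R * x) ^ n / R)
          = (\<lambda>n. real n ^ 2 * (p n + q n) * x ^ n)"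
      proof
        fix n :: nat
        show "(if n = 1 then x else 0) - extremal_weight 0 n * (R * x) ^ n / R
            = real n ^ 2 * (p n + q n) * x ^ n"
        proof (cases "n < 2")
          case True
          then have "n = 0 \<or> n = 1" by auto
          then show ?thesis using R0 by (auto simp: p_def q_def extremal_weight_def)
        next
          case False
          have uv_sum: "u n + v n = (2 * real n ^ 2 + 1) / 3"
            by (simp add: u_def v_def field_simps power2_eq_square)
          have pq: "p n + q n = - (real n * ((2 * real n ^ 2 + 1) / 3) * (R ^ n / R))"
            unfolding uv_sum[symmetric] using False by (simp add: p_def q_def algebra_simps add_divide_distrib)
          show ?thesis
            unfolding pq using False by (simp add: extremal_weight_def power_mult_distrib numeral_eq_Suc)
        qed
      qed
      finally have "turn (of_real x) = of_real (x + (x - R * x * (2 * (1 - 0)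
          - radius_poly 0 (R * x) / (1 - R * x) ^ 6) / R))"
        by (rule real_coefficients(2)[OF pA qB, rotated]) (use x in simp)
      also have "x + (x - R * x * (2 * (1 - 0) - radius_poly 0 (R * x) / (1 - R * x) ^ 6) / R) = x * \<tau> x"
        unfolding \<tau>_def using R0 by (simp add: right_diff_distrib diff_divide_distrib)
      finally show ?thesis .
    qed
    have cont: "continuous_on {0..<1} \<nu>"
    proof -
      have "1 - R * x \<noteq> 0" if "x \<in> {0..<1}" for x
        using Rx[of x] that by (cases "x = 0") auto
      then show ?thesis unfolding \<nu>_def by (intro continuous_intros) auto
    qed
    \<comment> \<open>any \<open>x < 1\<close> with \<open>rc < R * x\<close> will do\<close>
    define x where "x = (rc + R) / (2 * R)"
    have x: "0 < x" "x < 1" "rc < R * x" using rc R R0 by (auto simp: x_def field_simps)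
    have "\<alpha> * \<nu> x < \<tau> x"
      by (rule real_axis_criterion[OF \<alpha>(1) fc' n1 t1 cont]) (use x in \<open>auto simp: \<nu>_def\<close>)
    moreover have "\<tau> x - \<alpha> * \<nu> x = radius_poly \<alpha> (R * x) / (1 - R * x) ^ 6"
    proof -
      define d where "d = 1 - R * x"
      have d: "d \<noteq> 0" "R * x = 1 - d" using Rx[OF x(1,2)] by (auto simp: d_def)
      let ?Q = "1 + 4 * (1 - d) + (1 - d)\<^sup>2"
      have frac: "\<alpha> * (2 - Q / d ^ 4) = \<alpha> * (2 * (d ^ 4 * d\<^sup>2) - Q * d\<^sup>2) / (d ^ 4 * d\<^sup>2)" for Q
        using d(1) by (simp add: field_simps)
      have six: "d ^ 4 * d\<^sup>2 = d ^ 6" by (simp flip: power_add)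
      have id: "radius_poly 0 (1 - d) - \<alpha> * (2 * d ^ 6 - ?Q * d\<^sup>2) = radius_poly \<alpha> (1 - d)"
        unfolding radius_poly_def by (simp add: algebra_simps numeral_eq_Suc)
      have "\<tau> x - \<alpha> * \<nu> x = radius_poly 0 (1 - d) / d ^ 6 - \<alpha> * (2 - ?Q / d ^ 4)"
        unfolding \<tau>_def \<nu>_def d(2) by simp
      also have "\<dots> = (radius_poly 0 (1 - d) - \<alpha> * (2 * d ^ 6 - ?Q * d\<^sup>2)) / d ^ 6"
        unfolding frac six by (rule diff_divide_distrib[symmetric])
      also have "\<dots> = radius_poly \<alpha> (1 - d) / d ^ 6" unfolding id ..
      finally show ?thesis unfolding d(2) by simp
    qed
    moreover have "radius_poly \<alpha> (R * x) < 0"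
      using radius_poly_strict_decreasing[OF \<alpha>, of rc "R * x"] rc x Rx[OF x(1,2)] by auto
    then have "radius_poly \<alpha> (R * x) / (1 - R * x) ^ 6 < 0"
      using Rx[OF x(1,2)] by (intro divide_neg_pos) auto
    ultimately show False by linarith
  qed
  ultimately show ?thesis by blast
qed

lemma sharp_radius:
  assumes \<alpha>: "0 \<le> \<alpha>" "\<alpha> < 1"
  shows "\<exists>rc. 0 < rc \<and> rc < 1 \<and>
       (\<forall>r. 0 < r \<and> r < 1 \<longrightarrow> (radius_poly \<alpha> r = 0 \<longleftrightarrow> r = rc)) \<and>
       (\<forall>\<epsilon> f. norm \<epsilon> = 1 \<and> coeff_bounded_harmonic f \<longrightarrow>
          fully_convex_of_order \<alpha> (rescale rc (D_op \<epsilon> f))) \<and>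
       (\<forall>\<epsilon> R. norm \<epsilon> = 1 \<and> rc < R \<and> R \<le> 1 \<longrightarrow>
          (\<exists>f. coeff_bounded_harmonic f \<and>
               \<not> fully_convex_of_order \<alpha> (rescale R (D_op \<epsilon> f))))"
proof -
  obtain rc where rc: "0 < rc" "rc < 1" "\<forall>r. 0 < r \<and> r < 1 \<longrightarrow> (radius_poly \<alpha> r = 0 \<longleftrightarrow> r = rc)"
    using radius_poly_root[OF \<alpha>] by blast
  then have "radius_poly \<alpha> rc = 0" by blast
  with rc show ?thesis
    using fully_convex_up_to_root[OF \<alpha>] not_fully_convex_beyond_root[OF \<alpha>]
    by (intro exI[of _ rc]) blast
qed

theorem theorem2p3:
  fixes \<alpha> :: real
  assumes "0 \<le> \<alpha>" and "\<alpha> < 1"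
  shows "(\<exists>rc. 0 < rc \<and> rc < 1 \<and>
       (\<forall>r. 0 < r \<and> r < 1 \<longrightarrow>
          (1 - \<alpha> - 2 * (15 - 7 * \<alpha>) * r - 12 * (1 + 3 * \<alpha>) * r ^ 2 - 2 * (29 - 21 * \<alpha>) * r ^ 3
            + 29 * (1 - \<alpha>) * r ^ 4 - 12 * (1 - \<alpha>) * r ^ 5 + 2 * (1 - \<alpha>) * r ^ 6 = 0
           \<longleftrightarrow> r = rc)) \<and>
       (\<forall>\<epsilon> f. norm \<epsilon> = 1 \<and> coeff_bounded_harmonic f \<longrightarrow>
          fully_convex_of_order \<alpha> (rescale rc (D_op \<epsilon> f))) \<and>
       (\<forall>\<epsilon> R. norm \<epsilon> = 1 \<and> rc < R \<and> R \<le> 1 \<longrightarrow>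
          (\<exists>f. coeff_bounded_harmonic f \<and>
               \<not> fully_convex_of_order \<alpha> (rescale R (D_op \<epsilon> f)))))
     \<and>
     (\<exists>rc. 0 < rc \<and> rc < 1 \<and>
       (\<forall>r. 0 < r \<and> r < 1 \<longrightarrow>
          (1 - 30 * r - 12 * r ^ 2 - 58 * r ^ 3 + 29 * r ^ 4 - 12 * r ^ 5 + 2 * r ^ 6 = 0
           \<longleftrightarrow> r = rc)) \<and>
       \<bar>rc - 0.0328348\<bar> < 5 / 10 ^ 8 \<and>
       (\<forall>\<epsilon> f. norm \<epsilon> = 1 \<and> coeff_bounded_harmonic f \<longrightarrow>
          fully_convex (rescale rc (D_op \<epsilon> f))) \<and>
       (\<forall>\<epsilon> R. norm \<epsilon> = 1 \<and> rc < R \<and> R \<le> 1 \<longrightarrow>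
          (\<exists>f. coeff_bounded_harmonic f \<and>
               \<not> fully_convex (rescale R (D_op \<epsilon> f)))))"
proof (rule conjI)
  show "\<exists>rc. 0 < rc \<and> rc < 1 \<and>
       (\<forall>r. 0 < r \<and> r < 1 \<longrightarrow>
          (1 - \<alpha> - 2 * (15 - 7 * \<alpha>) * r - 12 * (1 + 3 * \<alpha>) * r ^ 2 - 2 * (29 - 21 * \<alpha>) * r ^ 3
            + 29 * (1 - \<alpha>) * r ^ 4 - 12 * (1 - \<alpha>) * r ^ 5 + 2 * (1 - \<alpha>) * r ^ 6 = 0
           \<longleftrightarrow> r = rc)) \<and>
       (\<forall>\<epsilon> f. norm \<epsilon> = 1 \<and> coeff_bounded_harmonic f \<longrightarrow>
          fully_convex_of_order \<alpha> (rescale rc (D_op \<epsilon> f))) \<and>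
       (\<forall>\<epsilon> R. norm \<epsilon> = 1 \<and> rc < R \<and> R \<le> 1 \<longrightarrow>
          (\<exists>f. coeff_bounded_harmonic f \<and>
               \<not> fully_convex_of_order \<alpha> (rescale R (D_op \<epsilon> f))))"
    using sharp_radius[OF assms] unfolding radius_poly_def .
next
  have P0: "radius_poly 0 r
      = 1 - 30 * r - 12 * r ^ 2 - 58 * r ^ 3 + 29 * r ^ 4 - 12 * r ^ 5 + 2 * r ^ 6" for r
    by (simp add: radius_poly_def)
  have approx: "\<bar>rc - 0.0328348\<bar> < 5 / 10 ^ 8" if "radius_poly 0 rc = 0" "0 < rc" "rc < 1" for rc
  proof -
    have lo: "radius_poly 0 (0.0328348 - 5 / 10 ^ 8) > 0" and hi: "radius_poly 0 (0.0328348 + 5 / 10 ^ 8) < 0"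
      by (simp_all add: radius_poly_def power_numeral_reduce field_simps)
    have "\<not> rc \<le> 0.0328348 - 5 / 10 ^ 8"
      using radius_poly_strict_decreasing[of 0 rc "0.0328348 - 5 / 10 ^ 8"] that lo
      by (cases "rc = 0.0328348 - 5 / 10 ^ 8") auto
    moreover have "\<not> rc \<ge> 0.0328348 + 5 / 10 ^ 8"
      using radius_poly_strict_decreasing[of 0 "0.0328348 + 5 / 10 ^ 8" rc] that hi
      by (cases "rc = 0.0328348 + 5 / 10 ^ 8") auto
    ultimately show ?thesis unfolding abs_less_iff by linarith
  qed
  obtain rc where rc: "0 < rc" "rc < 1" "\<forall>r. 0 < r \<and> r < 1 \<longrightarrow> (radius_poly 0 r = 0 \<longleftrightarrow> r = rc)"
    and rest: "\<forall>\<epsilon> f. norm \<epsilon> = 1 \<and> coeff_bounded_harmonic f \<longrightarrow> fully_convex (rescale rc (D_op \<epsilon> f))"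
      "\<forall>\<epsilon> R. norm \<epsilon> = 1 \<and> rc < R \<and> R \<le> 1 \<longrightarrow>
          (\<exists>f. coeff_bounded_harmonic f \<and> \<not> fully_convex (rescale R (D_op \<epsilon> f)))"
    using sharp_radius[of 0] by auto
  then have "\<bar>rc - 0.0328348\<bar> < 5 / 10 ^ 8" using approx by blast
  with rc(1,2) rc(3)[unfolded P0] rest show "\<exists>rc. 0 < rc \<and> rc < 1 \<and>
       (\<forall>r. 0 < r \<and> r < 1 \<longrightarrow>
          (1 - 30 * r - 12 * r ^ 2 - 58 * r ^ 3 + 29 * r ^ 4 - 12 * r ^ 5 + 2 * r ^ 6 = 0
           \<longleftrightarrow> r = rc)) \<and>
       \<bar>rc - 0.0328348\<bar> < 5 / 10 ^ 8 \<and>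
       (\<forall>\<epsilon> f. norm \<epsilon> = 1 \<and> coeff_bounded_harmonic f \<longrightarrow>
          fully_convex (rescale rc (D_op \<epsilon> f))) \<and>
       (\<forall>\<epsilon> R. norm \<epsilon> = 1 \<and> rc < R \<and> R \<le> 1 \<longrightarrow>
          (\<exists>f. coeff_bounded_harmonic f \<and>
               \<not> fully_convex (rescale R (D_op \<epsilon> f))))"
    by (intro exI[of _ rc] conjI)
qed

end
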